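(* Let $f\ge 1$ and $\mathbb{F}=\mathbb{F}_{2^f}$. The structure of the Clifford-Weil group $G_f$ is given by $$G_f\cong Z.(\mathbb{F}\oplus\mathbb{F}).\operatorname{SL}_2(\mathbb{F}),$$ where $Z\cong\mathbb{Z}/4\mathbb{Z}$ if $f$ is even, and $Z\cong\mathbb{Z}/8\mathbb{Z}$ if $f$ is odd. That is, there are normal subgroups $Z\le M$ of $G_f$ with $Z\cong \mathbb{Z}/4\mathbb{Z}$ (if $f$ is even) or $Z\cong\mathbb{Z}/8\mathbb{Z}$ (if $f$ is odd), $M/Z\cong\mathbb{F}\oplus\mathbb{F}$ (as additive group), and $G_f/M\cong\operatorname{SL}_2(\mathbb{F})$.
   Context: Let $\mathbb{F}=\mathbb{F}_{2^f}$ and let $\tau:\mathbb{F}\to\mathbb{F}_2$ be the trace. Fix a self-complementary (trace-orthogonal) basis of $\mathbb{F}$, i.e. an $\mathbb{F}_2$-basis $(b_1,\dots,b_f)$ with $\tau(b_ib_j)=\delta_{ij}$ for all $i,j$. Define $\varphi:\mathbb{F}\to\mathbb{Z}/4\mathbb{Z}$ by $\varphi(\sum_{i=1}^f a_ib_i)=\operatorname{wt}(a_1,\dots,a_f)+4\mathbb{Z}$ ($a_i\in\mathbb{F}_2$), where $\operatorname{wt}$ is the number of nonzero entries. Let $m_r$, $d_r$ (for $0\ne r\in\mathbb{F}$) and $h$ be the $\mathbb{C}$-algebra endomorphisms of $\mathbb{C}[x_a\mid a\in\mathbb{F}]$ given, for all $a\in\mathbb{F}$, by $$m_r(x_a)=x_{ar},\qquad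 d_r(x_a)=i^{\varphi(ar)}x_a,\qquad h(x_a)=2^{-f/2}\sum_{b\in\mathbb{F}}(-1)^{\tau(ab)}x_b,$$ where $i=\sqrt{-1}$. The Clifford-Weil group is $G_f=\langle h,m_r,d_r\mid 0\ne r\in\mathbb{F}\rangle$ (equivalently, a subgroup of $\operatorname{GL}_{2^f}(\mathbb{C})$ acting on $\bigoplus_{a\in\mathbb{F}}\mathbb{C}x_a$). Notation: $A.B$ denotes a (not necessarily split) group extension with normal subgroup isomorphic to $A$ and quotient isomorphic to $B$. *)

theory Defs
  imports
    "HOL-Analysis.Analysis"
    "HOL-Algebra.Elementary_Groups"
    "HOL-Library.Z2"
begin

text \<open>
  The field with \<open>2 ^ f\<close> elements is a type \<open>'a :: {field, finite}\<close> with \<open>CARD('a) = 2 ^ f\<close>;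
  its prime field is the type \<^typ>\<open>bit\<close>.  That \<^term>\<open>F2_scale\<close> is a vector space structure and
  that \<open>abs_trace f\<close> is the trace is only true under this assumption on the cardinality
  (see \<open>vector_space_F2_scale\<close> and \<open>of_bit_abs_trace\<close>).
\<close>

definition F2_scale :: "bit \<Rightarrow> 'a \<Rightarrow> 'a :: field" where
  "F2_scale c x = of_bit c * x"

text \<open>
  The sum of the Galois conjugates \<open>x ^ (2 ^ k)\<close> lies in \<open>{0, 1}\<close>, and is read as an element
  of \<^typ>\<open>bit\<close>.
\<close>

definition abs_trace :: "nat \<Rightarrow> 'a :: field \<Rightarrow> bit" where
  "abs_trace f x = (if (\<Sum>k<f. x ^ (2 ^ k)) = 0 then 0 else 1)"

definition F2_basis :: "nat \<Rightarrow> (nat \<Rightarrow> 'a :: field) \<Rightarrow> bool" where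
  "F2_basis f b \<longleftrightarrow> inj_on b {1..f}
     \<and> \<not> Modules.module.dependent F2_scale (b ` {1..f})
     \<and> Modules.module.span F2_scale (b ` {1..f}) = UNIV"

definition self_complementary_basis :: "nat \<Rightarrow> (nat \<Rightarrow> 'a :: field) \<Rightarrow> bool" where
  "self_complementary_basis f b \<longleftrightarrow> F2_basis f b
     \<and> (\<forall>i\<in>{1..f}. \<forall>j\<in>{1..f}. abs_trace f (b i * b j) = (if i = j then 1 else 0))"

text \<open>
  Values in \<open>\<int>/4\<int>\<close> are represented by their residues \<open>0, 1, 2, 3\<close>
  (see \<open>phi_sum\<close> for the defining property).
\<close>

definition phi :: "nat \<Rightarrow> (nat \<Rightarrow> 'a :: field) \<Rightarrow> 'a \<Rightarrow> nat" where
  "phi f b x =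
     card {i\<in>{1..f}. Modules.module.representation F2_scale (b ` {1..f}) x (b i) \<noteq> 0} mod 4"

type_synonym ('k, 'n) sqmat = "(('k, 'n) vec, 'n) vec"

definition GL :: "((complex, 'n :: finite) sqmat) monoid" where
  "GL = \<lparr>carrier = {A. invertible A}, monoid.mult = (**), one = mat 1\<rparr>"

text \<open>
  \<open>xvar a\<close> is the basis vector \<open>x\<^sub>a\<close> of the direct sum of the lines \<open>\<complex> x\<^sub>a\<close>, and
  \<open>lin_ext v\<close> is the matrix of the linear map with \<open>x\<^sub>a \<mapsto> v a\<close> for all \<open>a\<close>
  (see \<open>lin_ext_xvar\<close>); thus the product \<open>**\<close> is composition of maps.
\<close>

definition xvar :: "'a :: finite \<Rightarrow> (complex, 'a) vec" where
  "xvar a = axis a 1"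

definition lin_ext :: "('a :: finite \<Rightarrow> (complex, 'a) vec) \<Rightarrow> (complex, 'a) sqmat" where
  "lin_ext v = (\<chi> c a. v a $ c)"

definition m_gen :: "'a :: {field, finite} \<Rightarrow> (complex, 'a) sqmat" where
  "m_gen r = lin_ext (\<lambda>a. xvar (a * r))"

definition d_gen :: "nat \<Rightarrow> (nat \<Rightarrow> 'a) \<Rightarrow> 'a :: {field, finite} \<Rightarrow> (complex, 'a) sqmat" where
  "d_gen f b r = lin_ext (\<lambda>a. \<i> ^ phi f b (a * r) *s xvar a)"

definition h_gen :: "nat \<Rightarrow> (complex, 'a :: {field, finite}) sqmat" where
  "h_gen f = lin_ext (\<lambda>a. complex_of_real (2 powr (- real f / 2)) *s
     (\<Sum>c\<in>UNIV. (if abs_trace f (a * c) = 0 then 1 else - 1) *s xvar c))"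

definition clifford_weil :: "nat \<Rightarrow> (nat \<Rightarrow> 'a :: {field, finite}) \<Rightarrow> ((complex, 'a) sqmat) monoid" where
  "clifford_weil f b = GL\<lparr>carrier :=
     generate GL ({h_gen f} \<union> {m_gen r | r. r \<noteq> 0} \<union> {d_gen f b r | r. r \<noteq> 0})\<rparr>"

definition additive_group :: "'a :: ab_group_add monoid" where
  "additive_group = \<lparr>carrier = UNIV, monoid.mult = (+), one = 0\<rparr>"

definition SL2 :: "('a :: field, 2) sqmat monoid" where
  "SL2 = \<lparr>carrier = {A. det A = 1}, monoid.mult = (**), one = mat 1\<rparr>"

lemma lin_ext_xvar: "lin_ext v *v xvar a = v a"
  by (simp add: lin_ext_def xvar_def vec_eq_iff matrix_vector_mult_def axis_def if_distrib
        cong: if_cong)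

lemma invertible_mat_1: "invertible (mat 1 :: (complex, 'n :: finite) sqmat)"
  unfolding invertible_def by (rule exI[of _ "mat 1"]) simp

lemma group_GL: "group (GL :: ((complex, 'n :: finite) sqmat) monoid)"
proof (rule groupI)
  fix A :: "(complex, 'n :: finite) sqmat"
  assume "A \<in> carrier GL"
  then obtain B where "A ** B = mat 1" "B ** A = mat 1"
    by (auto simp: GL_def invertible_def)
  then show "\<exists>B\<in>carrier GL. B \<otimes>\<^bsub>GL\<^esub> A = \<one>\<^bsub>GL\<^esub>"
    by (auto simp: GL_def invertible_def intro!: bexI[of _ B])
qed (auto simp: GL_def invertible_mult matrix_mul_assoc invertible_mat_1)

context
  fixes f :: nat and t :: "'a :: {field, finite} itself"
  assumes card_field: "CARD('a) = 2 ^ f"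
begin

lemma field_power_card: "x ^ (2 ^ f) = (x :: 'a)"
proof (cases "x = 0")
  case False
  let ?U = "UNIV - {0 :: 'a}"
  have "bij_betw (\<lambda>y. x * y) ?U ?U"
    by (rule bij_betwI[of _ _ _ "\<lambda>y. y / x"]) (use False in auto)
  then have "prod (\<lambda>y. x * y) ?U = prod (\<lambda>y. y) ?U"
    by (rule prod.reindex_bij_betw)
  then have "x ^ card ?U * prod (\<lambda>y. y) ?U = prod (\<lambda>y. y) ?U"
    by (simp add: prod.distrib)
  then have "x ^ (2 ^ f - 1) = 1"
    by (simp add: card_field card_Diff_singleton)
  then have "x ^ Suc (2 ^ f - 1) = x"
    by (simp only: power_Suc mult_1_right)
  moreover have "Suc (2 ^ f - 1) = 2 ^ f"
    by simp
  ultimately show ?thesis by metis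
qed auto

lemma field_add_self: "(x :: 'a) + x = 0"
proof -
  have "(- 1 :: 'a) ^ (2 ^ f) = - 1"
    by (rule field_power_card)
  moreover have "f > 0"
    using card_field card_mono[of "UNIV :: 'a set" "{0, 1}"] by (cases f) auto
  then have "even (2 ^ f :: nat)"
    by simp
  ultimately have "(1 :: 'a) = - 1"
    by (metis power_minus_even power_one)
  then have "(1 :: 'a) + 1 = 0"
    by (metis add.right_inverse)
  then have "x * (1 + 1) = 0" by (simp only: mult_zero_right)
  then show ?thesis by (simp only: distrib_left mult_1_right)
qed

lemma vector_space_F2_scale: "Vector_Spaces.vector_space (F2_scale :: bit \<Rightarrow> 'a \<Rightarrow> 'a)"
proof
  fix c d :: bit and x y :: 'a
  show "F2_scale (c + d) x = F2_scale c x + F2_scale d x"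
    by (cases c; cases d) (simp_all add: F2_scale_def field_add_self)
qed (auto simp: F2_scale_def algebra_simps)

lemma field_square_add: "((x :: 'a) + y) ^ 2 = x ^ 2 + y ^ 2"
  using field_add_self[of "x * y"] by (simp add: power2_eq_square algebra_simps)

lemma field_square_sum: "finite A \<Longrightarrow> (\<Sum>k\<in>A. g k :: 'a) ^ 2 = (\<Sum>k\<in>A. g k ^ 2)"
  by (induction A rule: finite_induct) (simp_all add: field_square_add)

lemma of_bit_abs_trace: "of_bit (abs_trace f x) = (\<Sum>k<f. (x :: 'a) ^ (2 ^ k))"
proof -
  let ?t = "\<Sum>k<f. x ^ (2 ^ k)"
  have "?t ^ 2 = (\<Sum>k<f. x ^ (2 ^ Suc k))"
    by (simp add: field_square_sum mult.commute flip: power_mult)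
  also have "\<dots> + x = (\<Sum>k<Suc f. x ^ (2 ^ k))"
    by (subst sum.lessThan_Suc_shift) simp
  also have "\<dots> = ?t + x"
    by (simp add: field_power_card)
  finally have "?t * (?t - 1) = 0"
    by (simp add: power2_eq_square algebra_simps)
  then have "?t = 0 \<or> ?t = 1" by simp
  then show ?thesis by (auto simp: abs_trace_def)
qed

lemma phi_sum:
  fixes b :: "nat \<Rightarrow> 'a" and c :: "nat \<Rightarrow> bit"
  assumes b: "F2_basis f b"
  shows "phi f b (\<Sum>i=1..f. F2_scale (c i) (b i)) = card {i\<in>{1..f}. c i \<noteq> 0} mod 4"
proof -
  interpret V: Vector_Spaces.vector_space "F2_scale :: bit \<Rightarrow> 'a \<Rightarrow> 'a"
    by (rule vector_space_F2_scale)
  let ?B = "b ` {1..f}"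
  have inj: "inj_on b {1..f}" and ind: "V.independent ?B"
    using b by (auto simp: F2_basis_def)
  have "V.representation ?B (\<Sum>i=1..f. F2_scale (c i) (b i)) (b j) = c j" if j: "j \<in> {1..f}" for j
  proof -
    have "V.representation ?B (\<Sum>i=1..f. F2_scale (c i) (b i)) (b j)
        = (\<Sum>i=1..f. V.representation ?B (F2_scale (c i) (b i)) (b j))"
      by (subst V.representation_sum[OF ind]) (auto intro!: V.span_scale intro: V.span_base)
    also have "\<dots> = (\<Sum>i=1..f. if i = j then c i else 0)"
    proof (rule sum.cong)
      fix i assume i: "i \<in> {1..f}"
      then have i': "b i \<in> ?B" by blast
      have "b j = b i \<longleftrightarrow> i = j"
        using inj i j by (auto dest: inj_onD)
      then show "V.representation ?B (F2_scale (c i) (b i)) (b j) = (if i = j then c i else 0)"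
        by (simp only: V.representation_scale[OF ind V.span_base[OF i']]
            V.representation_basis[OF ind i']) simp
    qed simp
    also have "\<dots> = c j" using j by simp
    finally show ?thesis .
  qed
  then have "{i\<in>{1..f}. V.representation ?B (\<Sum>i=1..f. F2_scale (c i) (b i)) (b i) \<noteq> 0}
      = {i\<in>{1..f}. c i \<noteq> 0}"
    by auto
  then show ?thesis by (simp only: phi_def)
qed

end

end

theory Submission
  imports Defs
begin

text \<open>
  Let \<open>W s t\<close> be the Pauli matrix \<open>x\<^sub>a \<mapsto> (-1)\<^bsup>\<tau>(ta)\<^esup> x\<^sub>a\<^sub>+\<^sub>s\<close>.  Each generator conjugates \<open>W s t\<close>
  to a multiple of some \<open>W s' t'\<close>, where \<open>(s, t) \<mapsto> (s', t')\<close> is linear over the field and of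
  determinant 1; elementary matrices show that this homomorphism to \<open>SL\<^sub>2\<close> is surjective.  A matrix
  acting trivially is a scalar times some \<open>W s t\<close>, because the trace form is nondegenerate.  So the
  kernel is \<open>M = Z\<cdot>{W s t}\<close>, with \<open>Z\<close> the group of scalars, and \<open>M/Z\<close> is \<open>F \<oplus> F\<close>.

  To bound \<open>Z\<close>: up to a 4th root of unity (\<open>f\<close> even) or an 8th one (\<open>f\<close> odd), all group elements are
  unitary with entries in \<open>\<int>[\<i>, 1/2]\<close>, whose elements of absolute value 1 are the powers of \<open>\<i>\<close>.
  Conversely \<open>\<i>\<close> is a commutator of \<open>d\<^sub>1\<close> and some \<open>W x 0\<close> up to Pauli matrices, and for odd \<open>f\<close> a
  primitive 8th root of unity comes from \<open>(h d\<^sub>1)\<^sup>3\<close>.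
\<close>

section \<open>Additive characters, signs and powers of \<open>\<i>\<close>\<close>

definition additive_character :: "('a :: ab_group_add \<Rightarrow> complex) \<Rightarrow> bool" where
  "additive_character e \<longleftrightarrow> e 0 = 1 \<and> (\<forall>x y. e (x + y) = e x * e y)"

lemma additive_character_sum:
  assumes "additive_character e"
  shows "e (\<Sum>i\<in>I. g i) = (\<Prod>i\<in>I. e (g i))"
  using assms by (induction I rule: infinite_finite_induct) (auto simp: additive_character_def)

definition bit_sign :: "bit \<Rightarrow> complex" where
  "bit_sign u = (if u = 0 then 1 else - 1)"

lemma bit_sign_add: "bit_sign (u + v) = bit_sign u * bit_sign v"
  by (cases u; cases v) (simp_all add: bit_sign_def)

lemma bit_sign_eq_iff: "bit_sign u = bit_sign v \<longleftrightarrow> u = v"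
  by (cases u; cases v) (simp_all add: bit_sign_def)

lemma bit_sign_sum: "bit_sign (\<Sum>i\<in>I. u i) = (\<Prod>i\<in>I. bit_sign (u i))"
  by (induction I rule: infinite_finite_induct) (auto simp: bit_sign_add, auto simp: bit_sign_def)

lemma i_power_mod: "\<i> ^ (n mod 4) = \<i> ^ n"
proof -
  have "\<i> ^ n = \<i> ^ (4 * (n div 4) + n mod 4)" by simp
  also have "\<dots> = (\<i> ^ 4) ^ (n div 4) * \<i> ^ (n mod 4)" by (simp only: power_add power_mult)
  finally show ?thesis by simp
qed

section \<open>The trace form in a self-complementary basis\<close>

locale clifford_weil_setting =
  fixes f :: nat and b :: "nat \<Rightarrow> 'a :: {field, finite}"
  assumes f_pos: "f \<ge> 1"
    and card_field: "CARD('a) = 2 ^ f"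
    and basis: "self_complementary_basis f b"
begin

sublocale V: Vector_Spaces.vector_space "F2_scale :: bit \<Rightarrow> 'a \<Rightarrow> 'a"
  by (rule vector_space_F2_scale[OF card_field])

lemmas add_self = field_add_self[OF card_field]

lemma add_eq_0: "(x :: 'a) + y = 0 \<longleftrightarrow> x = y"
  by (metis add_self add_left_cancel)

lemma minus_eq: "- (x :: 'a) = x"
  using add_self[of x] by (simp add: minus_unique)

lemma add_add_self: "(x :: 'a) + (x + y) = y" "(y :: 'a) + x + x = y"
  by (simp_all add: add_self add.assoc flip: add.assoc[of x x])

abbreviation tr :: "'a \<Rightarrow> bit" where "tr \<equiv> abs_trace f"

lemma of_bit_tr: "of_bit (tr x) = (\<Sum>k<f. x ^ (2 ^ k))"
  by (rule of_bit_abs_trace[OF card_field])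

lemma of_bit_inject: "(of_bit u :: 'a) = of_bit v \<longleftrightarrow> u = v"
  by (cases u; cases v) auto

lemma field_power2k_add: "((x :: 'a) + y) ^ (2 ^ k) = x ^ (2 ^ k) + y ^ (2 ^ k)"
  by (induction k) (simp_all add: mult.commute[of 2] power_mult field_square_add[OF card_field])

lemma of_bit_add: "(of_bit (u + v) :: 'a) = of_bit u + of_bit v"
  by (cases u; cases v) (simp_all add: add_self)

text \<open>The power maps with exponent \<open>2 ^ k\<close> are additive, hence so is the sum of
  conjugates; injectivity of \<open>of_bit\<close> carries this from the field back to
  \<open>bit\<close>.\<close>

lemma tr_add: "tr (x + y) = tr x + tr y"
proof -
  have "(of_bit (tr (x + y)) :: 'a) = of_bit (tr x + tr y)"
    by (simp only: of_bit_add of_bit_tr field_power2k_add sum.distrib)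
  then show ?thesis by (simp only: of_bit_inject)
qed

lemma tr_0 [simp]: "tr 0 = 0"
  using tr_add[of 0 0] by (simp add: abs_trace_def)

lemma tr_sum: "tr (\<Sum>i\<in>I. g i) = (\<Sum>i\<in>I. tr (g i))"
  by (induction I rule: infinite_finite_induct) (simp_all only: sum.infinite sum.empty sum.insert tr_add tr_0 not_False_eq_True)

lemma tr_scale: "tr (F2_scale c x) = c * tr x"
  by (cases c) (auto simp: F2_scale_def)

text \<open>Squaring permutes the conjugates of \<open>x\<close> cyclically, so their sum does not
  change.\<close>

lemma tr_square: "tr (x * x) = tr x"
proof -
  have "(\<Sum>k<f. (x * x) ^ (2 ^ k)) = (\<Sum>k<f. x ^ (2 ^ Suc k))"
    by (simp flip: power2_eq_square power_mult)
  \<comment> \<open>Adding \<open>x\<close> completes the shifted sum to \<open>f + 1\<close>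
    conjugates, the last of which is \<open>x ^ (2 ^ f) = x\<close>.\<close>
  moreover have "\<dots> + x = (\<Sum>k<f. x ^ (2 ^ k)) + x"
    using sum.lessThan_Suc_shift[of "\<lambda>k. x ^ (2 ^ k)" f] field_power_card[OF card_field, of x]
    by simp
  ultimately show ?thesis
    using of_bit_tr[of x] of_bit_tr[of "x * x"] of_bit_inject by force
qed

lemma inj_b: "inj_on b {1..f}"
  and indep_b: "V.independent (b ` {1..f})"
  and span_b: "V.span (b ` {1..f}) = UNIV"
  and tr_b: "i \<in> {1..f} \<Longrightarrow> j \<in> {1..f} \<Longrightarrow> tr (b i * b j) = (if i = j then 1 else 0)"
  using basis by (auto simp: self_complementary_basis_def F2_basis_def)

lemma tr_b_combination:
  assumes "j \<in> {1..f}"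
  shows "tr (b j * (\<Sum>i=1..f. F2_scale (c i) (b i))) = c j"
proof -
  have "tr (b j * (\<Sum>i=1..f. F2_scale (c i) (b i))) = (\<Sum>i=1..f. c i * tr (b j * b i))"
    by (simp only: sum_distrib_left tr_sum tr_scale[symmetric]) (simp add: F2_scale_def mult_ac)
  also have "\<dots> = (\<Sum>i=1..f. if i = j then c i else 0)"
    using assms by (intro sum.cong) (auto simp: tr_b)
  also have "\<dots> = c j" using assms by simp
  finally show ?thesis .
qed

text \<open>The basis is its own dual for the trace form, so coordinates are traces. This replaces
  \<open>representation\<close> by expressions that are visibly additive in
  \<open>x\<close>.\<close>

lemma expansion: "x = (\<Sum>i=1..f. F2_scale (tr (b i * x)) (b i))"
proof -
  have "x \<in> V.span (b ` {1..f})" by (simp only: span_b UNIV_I)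
  then obtain u where "x = (\<Sum>v\<in>b ` {1..f}. F2_scale (u v) v)"
    by (auto simp: V.span_finite)
  then have x: "x = (\<Sum>i=1..f. F2_scale (u (b i)) (b i))"
    by (simp only: sum.reindex[OF inj_b] o_def)
  have "F2_scale (u (b i)) (b i) = F2_scale (tr (b i * x)) (b i)" if "i \<in> {1..f}" for i
    using tr_b_combination[OF that, of "\<lambda>i. u (b i)"] x by simp
  from sum.cong[OF refl this] x show ?thesis by (simp only:)
qed

lemma phi_eq: "phi f b x = card {i\<in>{1..f}. tr (b i * x) \<noteq> 0} mod 4"
proof -
  have "F2_basis f b" using basis by (simp add: self_complementary_basis_def)
  from phi_sum[OF card_field this, of "\<lambda>i. tr (b i * x)"]
  show ?thesis by (simp only: expansion[of x, symmetric])
qed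

section \<open>The character \<open>chi\<close> and the quadratic function
  \<open>i_phi\<close>\<close>

definition chi :: "'a \<Rightarrow> complex" where
  "chi x = bit_sign (tr x)"

lemma chi_0 [simp]: "chi 0 = 1"
  by (simp add: chi_def bit_sign_def)

lemma chi_add: "chi (x + y) = chi x * chi y"
  by (simp add: chi_def tr_add bit_sign_add del: add_bit_eq_xor)

lemma chi_nonzero [simp]: "chi x \<noteq> 0"
  by (simp add: chi_def bit_sign_def)

lemma chi_cases: "chi x = 1 \<or> chi x = - 1"
  by (simp add: chi_def bit_sign_def)

lemma cnj_chi [simp]: "cnj (chi x) = chi x"
  by (simp add: chi_def bit_sign_def)

lemma chi_square [simp]: "chi x * chi x = 1"
  by (simp add: chi_def bit_sign_def)

definition i_phi :: "'a \<Rightarrow> complex" where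
  "i_phi x = \<i> ^ phi f b x"

lemma i_phi_nonzero [simp]: "i_phi x \<noteq> 0"
  by (simp add: i_phi_def)

text \<open>Reduction modulo 4 is invisible to powers of \<open>\<i>\<close>. In product form,
  identities for \<open>i_phi\<close> can be checked one coordinate bit at a time.\<close>

lemma i_phi_prod: "i_phi x = (\<Prod>i=1..f. if tr (b i * x) = 0 then 1 else \<i>)"
proof -
  have "(\<Prod>i=1..f. if tr (b i * x) = 0 then 1 else \<i>) = (\<Prod>i\<in>{i\<in>{1..f}. tr (b i * x) \<noteq> 0}. \<i>)"
    by (rule prod.mono_neutral_cong_right) auto
  also have "\<dots> = \<i> ^ card {i\<in>{1..f}. tr (b i * x) \<noteq> 0}" by simp
  finally show ?thesis by (simp only: i_phi_def phi_eq i_power_mod)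
qed

text \<open>In coordinates of a trace-orthonormal basis, the trace form is the standard dot
  product.\<close>

lemma chi_mult_prod: "chi (x * y) = (\<Prod>i=1..f. bit_sign (tr (b i * x) * tr (b i * y)))"
proof -
  have "tr (x * y) = tr (\<Sum>i=1..f. F2_scale (tr (b i * x)) (b i * y))"
    by (subst expansion[of x]) (simp only: sum_distrib_right F2_scale_def mult.assoc)
  then have "tr (x * y) = (\<Sum>i=1..f. tr (b i * x) * tr (b i * y))"
    by (simp only: tr_sum tr_scale)
  then show ?thesis by (simp only: chi_def bit_sign_sum)
qed

text \<open>In exponents of \<open>\<i>\<close>: the polar form of the quadratic form \<open>\<phi>\<close> is \<open>2\<tau>(xy)\<close>.\<close>

lemma i_phi_add: "i_phi (x + y) = i_phi x * i_phi y * chi (x * y)"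
proof -
  have "(if u + v = 0 then 1 else \<i>) =
      (if u = 0 then 1 else \<i>) * (if v = 0 then 1 else \<i>) * bit_sign (u * v)" for u v :: bit
    by (cases u; cases v) (simp_all add: bit_sign_def)
  then show ?thesis
    by (simp only: i_phi_prod chi_mult_prod distrib_left tr_add prod.distrib)
qed

lemma i_phi_0 [simp]: "i_phi 0 = 1"
  by (simp add: i_phi_prod)

text \<open>Take \<open>y = x\<close> in \<open>i_phi_add\<close>: the left side becomes
  \<open>i_phi 0\<close>, and \<open>tr_square\<close> turns the polar factor into
  \<open>chi x\<close>.\<close>

lemma i_phi_square: "i_phi x * i_phi x = chi x"
proof -
  have "1 = i_phi x * i_phi x * chi x"
    using i_phi_add[of x x] by (simp add: add_self chi_def tr_square)
  then have "chi x = i_phi x * i_phi x * (chi x * chi x)" by (simp only: mult_1_left flip: mult.assoc)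
  then show ?thesis by simp
qed

text \<open>A basis vector has weight 1. This value supplies the scalar \<open>\<i>\<close> in
  \<open>mat_i_G\<close>.\<close>

lemma i_phi_basis: "i_phi (b 1) = \<i>"
proof -
  have "i_phi (b 1) = (\<Prod>i=1..f. if i = 1 then \<i> else 1)"
    using f_pos by (simp only: i_phi_prod, intro prod.cong) (auto simp: tr_b)
  also have "\<dots> = \<i>" using f_pos by simp
  finally show ?thesis .
qed

text \<open>As \<open>x + x = 0\<close>, the values of \<open>e\<close> are signs. The signs on the
  basis, read as bits, are the coordinates of \<open>t\<close>; both characters then agree on the
  basis, hence everywhere.\<close>

lemma additive_character_eq_chi:
  assumes "additive_character e"
  shows "\<exists>t. \<forall>x. e x = chi (t * x)"
proof -
  let ?c = "\<lambda>i. if e (b i) = 1 then 0 else 1 :: bit"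
  let ?t = "\<Sum>i=1..f. F2_scale (?c i) (b i)"
  have sq: "e x = 1 \<or> e x = - 1" for x
  proof -
    have "e x * e x = 1"
      using assms add_self[of x] unfolding additive_character_def by metis
    then show ?thesis by (simp add: square_eq_1_iff)
  qed
  have base: "e (F2_scale u (b i)) = chi (?t * F2_scale u (b i))" if "i \<in> {1..f}" for i u
  proof (cases u)
    case zero
    then show ?thesis using assms by (simp add: F2_scale_def additive_character_def)
  next
    case one
    have "tr (?t * b i) = ?c i"
      using tr_b_combination[OF that, of ?c] by (simp add: mult.commute)
    then show ?thesis using one sq[of "b i"] by (auto simp: F2_scale_def chi_def bit_sign_def)
  qed
  have "e x = chi (?t * x)" for x
  proof -
    have chr: "additive_character (\<lambda>y. chi (?t * y))"
      by (simp add: additive_character_def chi_add distrib_left)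
    have "e (\<Sum>i=1..f. F2_scale (tr (b i * x)) (b i))
        = chi (?t * (\<Sum>i=1..f. F2_scale (tr (b i * x)) (b i)))"
      unfolding additive_character_sum[OF assms] additive_character_sum[OF chr, of "\<lambda>i. F2_scale (tr (b i * x)) (b i)"]
      by (intro prod.cong refl base)
    then show ?thesis by (simp only: expansion[of x, symmetric])
  qed
  then show ?thesis by blast
qed

text \<open>Testing on basis vectors shows that \<open>s\<close> and \<open>t\<close> have the same
  coordinates.\<close>

lemma chi_nondegenerate:
  assumes "\<And>x. chi (s * x) = chi (t * x)"
  shows "s = t"
proof -
  have "tr (b i * s) = tr (b i * t)" for i
    using assms[of "b i"] by (simp add: chi_def bit_sign_eq_iff mult.commute)
  then show ?thesis
    using expansion[of s] expansion[of t] by simp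
qed

text \<open>Translating the summation index by \<open>y\<close> multiplies the sum by
  \<open>chi (t * y)\<close>; for \<open>t \<noteq> 0\<close> some \<open>y\<close> makes this
  factor differ from 1, so the sum vanishes.\<close>

lemma chi_orthogonality: "(\<Sum>x\<in>UNIV. chi (t * x)) = (if t = 0 then 2 ^ f else 0)"
proof (cases "t = 0")
  case True
  then show ?thesis by (simp add: card_field)
next
  case False
  then obtain y where "chi (t * y) \<noteq> 1"
    using chi_nondegenerate[of t 0] by auto
  have "(\<Sum>x\<in>UNIV. chi (t * x)) = (\<Sum>x\<in>UNIV. chi (t * (x + y)))"
    by (rule sum.reindex_bij_witness[of _ "\<lambda>x. x + y" "\<lambda>x. x + y"])
      (simp_all add: add_add_self)
  also have "\<dots> = (\<Sum>x\<in>UNIV. chi (t * x)) * chi (t * y)"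
    by (simp add: distrib_left chi_add sum_distrib_right)
  finally show ?thesis using False \<open>chi (t * y) \<noteq> 1\<close> by simp
qed

end

section \<open>The action on Pauli matrices\<close>

lemma mat_mult_nth: "(mat c ** A) $ i $ j = c * (A $ i $ j :: 'k :: comm_ring_1)"
  by (simp add: matrix_matrix_mult_def mat_def if_distrib[of "\<lambda>x. x * _"] cong: if_cong)

lemma mult_mat_nth: "(A ** mat c) $ i $ j = (A $ i $ j :: 'k :: comm_ring_1) * c"
  by (simp add: matrix_matrix_mult_def mat_def if_distrib[of "\<lambda>x. _ * x"] cong: if_cong)

lemma mat_commute: "mat c ** A = A ** mat (c :: 'k :: comm_ring_1)"
  by (simp add: vec_eq_iff mat_mult_nth mult_mat_nth mult.commute)

lemma mat_left_commute: "A ** (mat c ** B) = mat (c :: 'k :: comm_ring_1) ** (A ** B)"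
  by (metis mat_commute matrix_mul_assoc)

lemma mat_mult_mat: "mat c ** mat d = mat (c * d :: 'k :: comm_ring_1)"
  by (simp add: vec_eq_iff mat_mult_nth) (simp add: mat_def)

lemma mat_mat_mult: "mat c ** (mat d ** A) = mat (c * d :: 'k :: comm_ring_1) ** A"
  by (simp add: matrix_mul_assoc mat_mult_mat)

lemma mat_1_2_nth [simp]:
  "(mat 1 :: 'k :: zero_neq_one ^ 2 ^ 2) $ 1 $ 1 = 1" "(mat 1 :: 'k ^ 2 ^ 2) $ 1 $ 2 = 0"
  "(mat 1 :: 'k ^ 2 ^ 2) $ 2 $ 1 = 0" "(mat 1 :: 'k ^ 2 ^ 2) $ 2 $ 2 = 1"
  by (simp_all add: mat_def)

lemma lin_ext_nth: "lin_ext v $ i $ j = v j $ i"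
  by (simp add: lin_ext_def)

context clifford_weil_setting
begin

section \<open>Pauli matrices and their relations\<close>

definition W :: "'a \<Rightarrow> 'a \<Rightarrow> (complex, 'a) sqmat" where
  "W s t = lin_ext (\<lambda>a. chi (t * a) *s xvar (a + s))"

lemma chi_square_left: "chi x * (chi x * z) = z"
  by (simp flip: mult.assoc)

lemma eq_add_iff: "(i :: 'a) = j + s \<longleftrightarrow> j = i + s"
  by (metis add_add_self(2) add.commute)

lemma add_eq_iff: "(i :: 'a) + s = j \<longleftrightarrow> i = j + s"
  by (metis add_add_self(2) add.commute)

lemma two_eq_0 [simp]: "(2 :: 'a) = 0"
  by (metis add_self one_add_one)

lemma W_nth: "W s t $ i $ j = (if i = j + s then chi (t * j) else 0)"
  by (simp add: W_def lin_ext_nth xvar_def axis_def)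

lemma mult_W_nth: "(A ** W s t) $ i $ j = chi (t * j) * A $ i $ (j + s)"
  by (simp add: matrix_matrix_mult_def W_nth if_distrib[of "\<lambda>x. _ * x"] mult.commute cong: if_cong)

lemma W_mult_nth: "(W s t ** A) $ i $ j = chi (t * (i + s)) * A $ (i + s) $ j"
  unfolding matrix_matrix_mult_def W_nth
  by (simp add: eq_add_iff[of i] if_distrib[of "\<lambda>x. x * _"] cong: if_cong)

lemma W_0_0: "W 0 0 = mat 1"
  by (simp add: vec_eq_iff W_nth mat_def)

text \<open>The shift by \<open>s'\<close> is applied first, so the sign of the left factor is
  evaluated at a shifted index; the excess \<open>chi (t * s')\<close> is the cocycle of a
  Heisenberg group.\<close>

lemma W_mult_W: "W s t ** W s' t' = mat (chi (t * s')) ** W (s + s') (t + t')"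
proof -
  have "(W s t ** W s' t') $ i $ j = (mat (chi (t * s')) ** W (s + s') (t + t')) $ i $ j" for i j
    unfolding mult_W_nth[of "W s t"] mat_mult_nth W_nth
    by (simp add: distrib_left distrib_right chi_add add_ac)
  then show ?thesis by (simp add: vec_eq_iff)
qed

text \<open>Column 0 has a single nonzero entry, whose row is the shift and whose value is the
  scalar; the remaining signs determine \<open>t\<close> by nondegeneracy.\<close>

lemma W_eq_iff:
  assumes "mat c ** W s t = mat d ** W s' t'" "c \<noteq> 0"
  shows "c = d \<and> s = s' \<and> t = t'"
proof -
  have *: "c * (if i = j + s then chi (t * j) else 0) = d * (if i = j + s' then chi (t' * j) else 0)" for i j
    using arg_cong[OF assms(1), of "\<lambda>A. A $ i $ j"] by (simp only: mat_mult_nth W_nth)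
  from *[of s 0] assms(2) have s: "s = s'" and c: "c = d" by (auto split: if_splits)
  have "chi (t * j) = chi (t' * j)" for j
    using *[of "j + s" j] s c assms(2) by simp
  then show ?thesis using s c chi_nondegenerate by blast
qed

text \<open>Conjugation up to scalars, written as an intertwining relation so that no inverse of
  \<open>A\<close> appears: \<open>g\<close> multiplies the column vector of the label
  \<open>(s, t)\<close>. The scalar may depend on the label.\<close>

definition acts :: "(complex, 'a) sqmat \<Rightarrow> 'a ^ 2 ^ 2 \<Rightarrow> bool" where
  "acts A g \<longleftrightarrow> (\<forall>s t. \<exists>c. c \<noteq> 0 \<and>
     A ** W s t = mat c ** (W (g $ 1 $ 1 * s + g $ 1 $ 2 * t) (g $ 2 $ 1 * s + g $ 2 $ 2 * t) ** A))"

lemma acts_mat_1: "acts (mat 1) (mat 1)"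
proof -
  show ?thesis
    unfolding acts_def by (intro allI exI[of _ 1]) simp
qed

lemma acts_mult:
  assumes "acts A g" "acts B h"
  shows "acts (A ** B) (g ** h)"
  unfolding acts_def
proof (intro allI)
  fix s t
  let ?s = "h $ 1 $ 1 * s + h $ 1 $ 2 * t" and ?t = "h $ 2 $ 1 * s + h $ 2 $ 2 * t"
  let ?u = "g $ 1 $ 1 * ?s + g $ 1 $ 2 * ?t" and ?v = "g $ 2 $ 1 * ?s + g $ 2 $ 2 * ?t"
  obtain c where c: "c \<noteq> 0" "B ** W s t = mat c ** (W ?s ?t ** B)"
    using assms(2) unfolding acts_def by blast
  obtain d where d: "d \<noteq> 0" "A ** W ?s ?t = mat d ** (W ?u ?v ** A)"
    using assms(1) unfolding acts_def by blast
  have "(A ** B) ** W s t = mat c ** ((A ** W ?s ?t) ** B)"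
    by (simp only: c(2) mat_left_commute flip: matrix_mul_assoc)
  also have "\<dots> = mat (c * d) ** (W ?u ?v ** (A ** B))"
    by (simp only: d(2) mat_mat_mult flip: matrix_mul_assoc)
  finally have *: "(A ** B) ** W s t = mat (c * d) ** (W ?u ?v ** (A ** B))" .
  have uv: "?u = (g ** h) $ 1 $ 1 * s + (g ** h) $ 1 $ 2 * t"
    "?v = (g ** h) $ 2 $ 1 * s + (g ** h) $ 2 $ 2 * t"
    by (simp_all add: matrix_matrix_mult_def sum_2 algebra_simps)
  show "\<exists>c. c \<noteq> 0 \<and> (A ** B) ** W s t = mat c ** (W ((g ** h) $ 1 $ 1 * s + (g ** h) $ 1 $ 2 * t)
      ((g ** h) $ 2 $ 1 * s + (g ** h) $ 2 $ 2 * t) ** (A ** B))"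
    unfolding uv[symmetric] using * c(1) d(1) by (intro exI[of _ "c * d"]) simp
qed

text \<open>The relation for \<open>A\<close> is used at the label \<open>h\<close> applied to
  \<open>(s, t)\<close>, which \<open>g\<close> sends back to \<open>(s, t)\<close>; multiplying by
  \<open>B\<close> on both sides gives the relation for \<open>B\<close>.\<close>

lemma acts_inverse:
  assumes "acts A g" "A ** B = mat 1" "B ** A = mat 1" "g ** h = mat 1"
  shows "acts B h"
  unfolding acts_def
proof (intro allI)
  fix s t
  let ?s = "h $ 1 $ 1 * s + h $ 1 $ 2 * t" and ?t = "h $ 2 $ 1 * s + h $ 2 $ 2 * t"
  have e: "g $ 1 $ 1 * h $ 1 $ 1 + g $ 1 $ 2 * h $ 2 $ 1 = 1" "g $ 1 $ 1 * h $ 1 $ 2 + g $ 1 $ 2 * h $ 2 $ 2 = 0"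
    "g $ 2 $ 1 * h $ 1 $ 1 + g $ 2 $ 2 * h $ 2 $ 1 = 0" "g $ 2 $ 1 * h $ 1 $ 2 + g $ 2 $ 2 * h $ 2 $ 2 = 1"
    using assms(4) by (simp_all add: vec_eq_iff matrix_matrix_mult_def sum_2 forall_2 mat_def)
  have "g $ 1 $ 1 * ?s + g $ 1 $ 2 * ?t = (g $ 1 $ 1 * h $ 1 $ 1 + g $ 1 $ 2 * h $ 2 $ 1) * s
      + (g $ 1 $ 1 * h $ 1 $ 2 + g $ 1 $ 2 * h $ 2 $ 2) * t"
    "g $ 2 $ 1 * ?s + g $ 2 $ 2 * ?t = (g $ 2 $ 1 * h $ 1 $ 1 + g $ 2 $ 2 * h $ 2 $ 1) * s
      + (g $ 2 $ 1 * h $ 1 $ 2 + g $ 2 $ 2 * h $ 2 $ 2) * t"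
    by (simp_all add: algebra_simps)
  then have st: "g $ 1 $ 1 * ?s + g $ 1 $ 2 * ?t = s" "g $ 2 $ 1 * ?s + g $ 2 $ 2 * ?t = t"
    by (simp_all add: e)
  obtain c where c: "c \<noteq> 0" "A ** W ?s ?t = mat c ** (W s t ** A)"
    using assms(1)[unfolded acts_def, rule_format, of ?s ?t] unfolding st by blast
  have "W ?s ?t ** B = (B ** A) ** W ?s ?t ** B"
    by (simp add: assms(3))
  also have "\<dots> = B ** (A ** W ?s ?t) ** B"
    by (simp only: matrix_mul_assoc)
  also have "\<dots> = mat c ** (B ** W s t ** (A ** B))"
    by (simp only: c(2) mat_left_commute flip: matrix_mul_assoc)
  also have "\<dots> = mat c ** (B ** W s t)"
    by (simp add: assms(2))
  finally have "B ** W s t = mat (1 / c) ** (W ?s ?t ** B)"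
    using c(1) by (simp add: mat_mat_mult)
  then show "\<exists>c. c \<noteq> 0 \<and> B ** W s t = mat c ** (W ?s ?t ** B)"
    using c(1) by (intro exI[of _ "1 / c"]) simp
qed

text \<open>Cancelling \<open>A\<close> leaves two multiples of Pauli matrices, whose labels agree
  by \<open>W_eq_iff\<close>; the labels \<open>(1, 0)\<close> and \<open>(0, 1)\<close> then read
  off the columns. This makes \<open>SL2_action\<close> well defined.\<close>

lemma acts_unique:
  assumes "acts A g" "acts A h" "invertible A"
  shows "g = h"
proof -
  obtain B where B: "A ** B = mat 1"
    using assms(3) by (auto simp: invertible_def)
  have *: "g $ 1 $ 1 * s + g $ 1 $ 2 * t = h $ 1 $ 1 * s + h $ 1 $ 2 * t \<and>
      g $ 2 $ 1 * s + g $ 2 $ 2 * t = h $ 2 $ 1 * s + h $ 2 $ 2 * t" for s t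
  proof -
    let ?g = "W (g $ 1 $ 1 * s + g $ 1 $ 2 * t) (g $ 2 $ 1 * s + g $ 2 $ 2 * t)"
    let ?h = "W (h $ 1 $ 1 * s + h $ 1 $ 2 * t) (h $ 2 $ 1 * s + h $ 2 $ 2 * t)"
    obtain c d where c: "c \<noteq> 0" "A ** W s t = mat c ** (?g ** A)" "A ** W s t = mat d ** (?h ** A)"
      using assms(1)[unfolded acts_def, rule_format, of s t]
        assms(2)[unfolded acts_def, rule_format, of s t] by blast
    have "A ** W s t ** B = mat c ** ?g" "A ** W s t ** B = mat d ** ?h"
      by (simp only: c(2) B matrix_mul_rid flip: matrix_mul_assoc,
          simp only: c(3) B matrix_mul_rid flip: matrix_mul_assoc)
    then have "mat c ** ?g = mat d ** ?h" by (rule trans[OF sym])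
    from W_eq_iff[OF this c(1)] show ?thesis by blast
  qed
  from *[of 1 0] *[of 0 1] show ?thesis
    by (simp add: vec_eq_iff forall_2)
qed

text \<open>Pauli matrices commute up to sign, so conjugation by one fixes every label.\<close>

lemma acts_W: "acts (mat c ** W s t) (mat 1)"
  unfolding acts_def
proof (intro allI)
  fix u v
  have "(mat c ** W s t) ** W u v = mat (chi (t * u) * chi (v * s)) ** (W u v ** (mat c ** W s t))"
    unfolding matrix_mul_assoc[symmetric] mat_left_commute[of "W u v"] W_mult_W mat_mat_mult
    by (simp add: add.commute[of s] add.commute[of t] chi_square_left mult_ac)
  then show "\<exists>d. d \<noteq> 0 \<and> (mat c ** W s t) ** W u v = mat d ** (W ((mat 1 :: 'a ^ 2 ^ 2) $ 1 $ 1 * u + (mat 1 :: 'a ^ 2 ^ 2) $ 1 $ 2 * v)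
      ((mat 1 :: 'a ^ 2 ^ 2) $ 2 $ 1 * u + (mat 1 :: 'a ^ 2 ^ 2) $ 2 $ 2 * v) ** (mat c ** W s t))"
    by (intro exI[of _ "chi (t * u) * chi (v * s)"]) simp
qed

text \<open>Commuting with the \<open>W 0 t\<close> up to scalars confines the support of \<open>A\<close> to a translate of the
  diagonal; commuting with the \<open>W s 0\<close> then makes the entries an additive character.\<close>

lemma acts_trivially_imp_W:
  assumes "acts A (mat 1)" "A \<noteq> 0"
  shows "\<exists>c s t. A = mat c ** W s t"
proof -
  have "\<exists>c. c \<noteq> 0 \<and> A ** W s t = mat c ** (W s t ** A)" for s t
    using assms(1)[unfolded acts_def, rule_format, of s t] by simp
  then obtain c where c0: "c s t \<noteq> 0" and c: "A ** W s t = mat (c s t) ** (W s t ** A)" for s t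
    by metis
  have comm: "chi (t * j) * A $ i $ (j + s) = c s t * chi (t * (i + s)) * A $ (i + s) $ j" for s t i j
    using arg_cong[OF c[of s t], of "\<lambda>A. A $ i $ j"] by (simp add: mult_W_nth mat_mult_nth W_mult_nth)
  obtain i0 j0 where ij: "A $ i0 $ j0 \<noteq> 0"
    using assms(2) by (auto simp: vec_eq_iff)
  define s where "s = i0 + j0"
  have chi_c: "chi (t * (i + j)) = c 0 t" if "A $ i $ j \<noteq> 0" for i j t
  proof -
    have "chi (t * j) = c 0 t * chi (t * i)"
      using comm[of t j i 0] that by simp
    then have "chi (t * j) * chi (t * i) = c 0 t * (chi (t * i) * chi (t * i))"
      by (simp only: mult.assoc)
    then show ?thesis by (simp add: distrib_left chi_add mult.commute)
  qed
  have "i + j = s" if "A $ i $ j \<noteq> 0" for i j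
    using chi_c[OF that] chi_c[OF ij]
    by (intro chi_nondegenerate) (simp add: s_def mult.commute)
  then have supp: "A $ i $ j = 0" if "i \<noteq> j + s" for i j
    using that by (metis add_add_self(1) add.commute)
  define D where "D j = A $ (j + s) $ j" for j
  have D: "D (j + u) = c u 0 * D j" for j u
    using comm[of 0 j "j + u + s" u] by (simp add: D_def add_ac add_add_self)
  have "D j0 \<noteq> 0" using ij by (simp add: D_def s_def add_add_self add.commute)
  then have D0: "D 0 \<noteq> 0" using D[of 0 j0] by auto
  have "D (x + y) / D 0 = D x / D 0 * (D y / D 0)" for x y
    unfolding D[of x y] using D[of 0 y] D0 by simp
  then have "additive_character (\<lambda>x. D x / D 0)"
    using D0 by (simp add: additive_character_def)
  then obtain t where t: "D x / D 0 = chi (t * x)" for x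
    using additive_character_eq_chi by blast
  have "A = mat (D 0) ** W s t"
    using supp t D0 by (auto simp: vec_eq_iff mat_mult_nth W_nth D_def field_simps)
  then show ?thesis by blast
qed

section \<open>The generators and their action on labels\<close>

definition kappa :: complex where
  "kappa = complex_of_real (2 powr (- real f / 2))"

lemma m_gen_nth: "m_gen r $ i $ j = (if i = j * r then 1 else 0)" for r :: 'a
  by (simp add: m_gen_def lin_ext_nth xvar_def axis_def)

lemma d_gen_nth: "d_gen f b r $ i $ j = (if i = j then i_phi (j * r) else 0)"
  by (simp add: d_gen_def lin_ext_nth xvar_def axis_def i_phi_def)

lemma h_gen_nth: "h_gen f $ i $ j = kappa * chi (j * i)" for i :: 'a
proof -
  have "(\<Sum>c\<in>UNIV. (if abs_trace f (j * c) = 0 then 1 else - 1) *s xvar c) $ i = chi (j * i)"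
    by (simp add: xvar_def axis_def chi_def bit_sign_def if_distrib[of "\<lambda>x. x * _"] if_distrib[of "\<lambda>x. _ * x"]
        cong: if_cong)
  then show ?thesis by (simp add: h_gen_def lin_ext_nth kappa_def)
qed

text \<open>By \<open>i_phi_add\<close>, a shift of the index by \<open>s\<close> changes the
  diagonal entry by the constant \<open>i_phi (s * r)\<close> and a sign linear in the index; that
  sign adds \<open>r * r * s\<close> to \<open>t\<close>.\<close>

lemma d_gen_W: "d_gen f b r ** W s t = mat (i_phi (s * r)) ** (W s (t + r * r * s) ** d_gen f b r)"
proof -
  have "chi (t * j) * d_gen f b r $ i $ (j + s)
      = i_phi (s * r) * (chi ((t + r * r * s) * (i + s)) * d_gen f b r $ (i + s) $ j)" for i j
  proof (cases "i = j + s")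
    case True
    then have "i + s = j" by (simp add: add_add_self)
    then show ?thesis
      using True by (simp add: d_gen_nth distrib_right distrib_left i_phi_add chi_add mult_ac)
  next
    case False
    then show ?thesis by (simp add: d_gen_nth add_eq_iff)
  qed
  then show ?thesis by (simp add: vec_eq_iff mult_W_nth mat_mult_nth W_mult_nth)
qed

text \<open>\<open>h_gen\<close> is a Fourier transform: it exchanges translations with
  multiplication by characters.\<close>

lemma h_gen_W: "h_gen f ** W s t = mat (chi (s * t)) ** (W t s ** h_gen f)"
proof -
  have "chi (t * j) * (kappa * chi ((j + s) * i))
      = chi (s * t) * (chi (s * (i + t)) * (kappa * chi (j * (i + t))))" for i j
  proof -
    have "chi (s * t) * (chi (s * (i + t)) * (kappa * chi (j * (i + t))))
      = (chi (s * t) * chi (s * t)) * (chi (s * i) * kappa * chi (j * i) * chi (j * t))"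
      by (simp only: distrib_left chi_add mult_ac)
    then show ?thesis by (simp add: distrib_left distrib_right chi_add mult_ac)
  qed
  then show ?thesis
    by (simp add: vec_eq_iff mult_W_nth mat_mult_nth W_mult_nth h_gen_nth)
qed

text \<open>Scaling indices by \<open>r\<close> scales shifts by \<open>r\<close> and, to preserve
  the product of \<open>t\<close> with the index, character labels by \<open>1 / r\<close>.\<close>

lemma m_gen_W: "r \<noteq> 0 \<Longrightarrow> m_gen r ** W s t = W (s * r) (t / r) ** m_gen r"
proof -
  assume r: "r \<noteq> 0"
  have "chi (t * j) * m_gen r $ i $ (j + s) = chi (t / r * (i + s * r)) * m_gen r $ (i + s * r) $ j" for i j
  proof (cases "i = (j + s) * r")
    case True
    then have "i + s * r = j * r" by (simp add: distrib_right add_add_self)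
    then show ?thesis using True r by (simp add: m_gen_nth)
  next
    case False
    then show ?thesis by (simp add: m_gen_nth add_eq_iff distrib_right)
  qed
  then show ?thesis by (simp add: vec_eq_iff mult_W_nth W_mult_nth)
qed

definition mat2 :: "'k \<Rightarrow> 'k \<Rightarrow> 'k \<Rightarrow> 'k \<Rightarrow> 'k :: zero ^ 2 ^ 2" where
  "mat2 x y z w = vector [vector [x, y], vector [z, w]]"

lemma mat2_nth [simp]: "mat2 x y z w $ 1 $ 1 = x" "mat2 x y z w $ 1 $ 2 = y"
  "mat2 x y z w $ 2 $ 1 = z" "mat2 x y z w $ 2 $ 2 = w"
  by (simp_all add: mat2_def)

lemma acts_d_gen: "acts (d_gen f b r) (mat2 1 0 (r * r) 1)"
  unfolding acts_def
proof (intro allI)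
  fix s t
  show "\<exists>c. c \<noteq> 0 \<and> d_gen f b r ** W s t = mat c ** (W (mat2 1 0 (r * r) 1 $ 1 $ 1 * s + mat2 1 0 (r * r) 1 $ 1 $ 2 * t)
      (mat2 1 0 (r * r) 1 $ 2 $ 1 * s + mat2 1 0 (r * r) 1 $ 2 $ 2 * t) ** d_gen f b r)"
    by (intro exI[of _ "i_phi (s * r)"]) (simp add: d_gen_W add.commute)
qed

lemma acts_h_gen: "acts (h_gen f) (mat2 0 1 1 0)"
  unfolding acts_def
proof (intro allI)
  fix s t
  show "\<exists>c. c \<noteq> 0 \<and> h_gen f ** W s t = mat c ** (W (mat2 0 1 1 0 $ 1 $ 1 * s + mat2 0 1 1 0 $ 1 $ 2 * t)
      (mat2 0 1 1 0 $ 2 $ 1 * s + mat2 0 1 1 0 $ 2 $ 2 * t) ** h_gen f)"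
    by (intro exI[of _ "chi (s * t)"]) (simp add: h_gen_W)
qed

lemma acts_m_gen: "r \<noteq> 0 \<Longrightarrow> acts (m_gen r) (mat2 r 0 0 (1 / r))"
  unfolding acts_def by (intro allI exI[of _ 1]) (simp add: m_gen_W mult.commute)

end

section \<open>Scalars and unitarity\<close>

definition dyadic_gaussian :: "complex set" where
  "dyadic_gaussian = {z. \<exists>(a :: int) (b :: int) k. z * 2 ^ k = Complex (of_int a) (of_int b)}"

lemma dyadic_gaussianI: "z * 2 ^ k = Complex (of_int a) (of_int b) \<Longrightarrow> z \<in> dyadic_gaussian"
  unfolding dyadic_gaussian_def by blast

lemma dyadic_gaussian_mult:
  assumes "z \<in> dyadic_gaussian" "w \<in> dyadic_gaussian"
  shows "z * w \<in> dyadic_gaussian"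
proof -
  obtain a b k c d l where z: "z * 2 ^ k = Complex (of_int a) (of_int b)"
    and w: "w * 2 ^ l = Complex (of_int c) (of_int d)"
    using assms unfolding dyadic_gaussian_def by blast
  have "(z * 2 ^ k) * (w * 2 ^ l) = Complex (of_int (a * c - b * d)) (of_int (a * d + b * c))"
    unfolding z w by (simp add: complex_eq_iff)
  then have "(z * w) * 2 ^ (k + l) = Complex (of_int (a * c - b * d)) (of_int (a * d + b * c))"
    by (simp add: power_add mult_ac)
  then show ?thesis by (rule dyadic_gaussianI)
qed

lemma dyadic_gaussian_add:
  assumes "z \<in> dyadic_gaussian" "w \<in> dyadic_gaussian"
  shows "z + w \<in> dyadic_gaussian"
proof -
  obtain a b k c d l where z: "z * 2 ^ k = Complex (of_int a) (of_int b)"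
    and w: "w * 2 ^ l = Complex (of_int c) (of_int d)"
    using assms unfolding dyadic_gaussian_def by blast
  have "(z + w) * 2 ^ (k + l) = (z * 2 ^ k) * of_int (2 ^ l) + (w * 2 ^ l) * of_int (2 ^ k)"
    by (simp add: power_add algebra_simps)
  also have "\<dots> = Complex (of_int (a * 2 ^ l + c * 2 ^ k)) (of_int (b * 2 ^ l + d * 2 ^ k))"
    unfolding z w by (simp only: complex_eq_iff) simp
  finally have "(z + w) * 2 ^ (k + l) = Complex (of_int (a * 2 ^ l + c * 2 ^ k)) (of_int (b * 2 ^ l + d * 2 ^ k))" .
  then show ?thesis by (rule dyadic_gaussianI)
qed

lemma dyadic_gaussian_0 [simp]: "0 \<in> dyadic_gaussian"
  by (rule dyadic_gaussianI[of _ 0 0 0]) (simp add: complex_eq_iff)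

lemma dyadic_gaussian_1 [simp]: "1 \<in> dyadic_gaussian"
  by (rule dyadic_gaussianI[of _ 0 1 0]) (simp add: complex_eq_iff)

lemma dyadic_gaussian_m1 [simp]: "- 1 \<in> dyadic_gaussian"
  by (rule dyadic_gaussianI[of _ 0 "- 1" 0]) (simp add: complex_eq_iff)

lemma dyadic_gaussian_i [simp]: "\<i> \<in> dyadic_gaussian"
  by (rule dyadic_gaussianI[of _ 0 0 1]) (simp add: complex_eq_iff)

lemma dyadic_gaussian_power: "z \<in> dyadic_gaussian \<Longrightarrow> z ^ k \<in> dyadic_gaussian"
  by (induction k) (simp_all add: dyadic_gaussian_mult)

lemma dyadic_gaussian_sum: "(\<And>i. i \<in> I \<Longrightarrow> g i \<in> dyadic_gaussian) \<Longrightarrow> sum g I \<in> dyadic_gaussian"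
  by (induction I rule: infinite_finite_induct) (simp_all add: dyadic_gaussian_add)

lemma dyadic_gaussian_cnj:
  assumes "z \<in> dyadic_gaussian"
  shows "cnj z \<in> dyadic_gaussian"
proof -
  obtain a b k where z: "z * 2 ^ k = Complex (of_int a) (of_int b)"
    using assms unfolding dyadic_gaussian_def by blast
  have "cnj z * 2 ^ k = cnj (z * 2 ^ k)" by simp
  also have "\<dots> = Complex (of_int a) (of_int (- b))"
    unfolding z by (simp add: complex_eq_iff)
  finally have "cnj z * 2 ^ k = Complex (of_int a) (of_int (- b))" .
  then show ?thesis by (rule dyadic_gaussianI)
qed

text \<open>Descent on \<open>k\<close>: squares are 0 or 1 modulo 4, so a sum of two squares
  divisible by 4 has both terms even, and halving lowers the exponent.\<close>

lemma sum_squares_eq_4_power: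
  fixes a b :: int
  shows "a ^ 2 + b ^ 2 = 4 ^ k \<Longrightarrow> a = 0 \<or> b = 0"
proof (induction k arbitrary: a b)
  case 0
  show ?case
  proof (rule ccontr)
    assume "\<not> (a = 0 \<or> b = 0)"
    then have "a ^ 2 > 0" "b ^ 2 > 0" by simp_all
    with 0 show False by simp
  qed
next
  case (Suc k)
  have "(a ^ 2 + b ^ 2) mod 4 = 0"
    by (simp add: Suc.prems)
  have "even a \<and> even b"
  proof (rule ccontr)
    assume "\<not> (even a \<and> even b)"
    moreover have sq: "x ^ 2 mod 4 = (if even x then 0 else 1)" for x :: int
    proof (cases "even x")
      case True
      then show ?thesis by (auto elim!: evenE simp: power2_eq_square)
    next
      case False
      then obtain y where "x = 2 * y + 1" by (rule oddE)
      then have "x ^ 2 = 1 + (y ^ 2 + y) * 4" by (simp add: power2_eq_square algebra_simps)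
      then have "x ^ 2 mod 4 = 1 mod 4" by (simp only: mod_mult_self1)
      then show ?thesis using False by simp
    qed
    ultimately show False
      using \<open>(a ^ 2 + b ^ 2) mod 4 = 0\<close> mod_add_eq[of "a ^ 2" 4 "b ^ 2"] sq[of a] sq[of b]
      by (simp split: if_splits)
  qed
  then obtain x y where "a = 2 * x" "b = 2 * y" by (auto elim!: evenE)
  with Suc.prems have "x ^ 2 + y ^ 2 = 4 ^ k" by (simp add: power_mult_distrib)
  from Suc.IH[OF this] show ?case using \<open>a = 2 * x\<close> \<open>b = 2 * y\<close> by simp
qed

text \<open>After clearing the denominator, the real and imaginary parts satisfy
  \<open>a ^ 2 + b ^ 2 = 4 ^ k\<close>, so one of them is zero and the fourth power is a positive
  integer.\<close>

lemma dyadic_gaussian_norm_1: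
  assumes "z \<in> dyadic_gaussian" "norm z = 1"
  shows "z ^ 4 = 1"
proof -
  obtain a b k where z: "z * 2 ^ k = Complex (of_int a) (of_int b)"
    using assms unfolding dyadic_gaussian_def by blast
  have "(norm (z * 2 ^ k)) ^ 2 = 4 ^ k"
    using power_mult[of "2 :: real" k 2] power_mult[of "2 :: real" 2 k] assms(2)
    by (simp add: norm_mult norm_power mult.commute)
  then have "of_int (a ^ 2 + b ^ 2) = (of_int (4 ^ k) :: real)"
    by (simp add: z cmod_power2)
  then have ab: "a ^ 2 + b ^ 2 = 4 ^ k" by (simp only: of_int_eq_iff)
  have "(z * 2 ^ k) ^ 4 = of_int ((a ^ 2 + b ^ 2) ^ 2)"
  proof (cases "a = 0")
    case True
    then have "z * 2 ^ k = \<i> * of_int b" using z by (simp add: complex_eq_iff)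
    then show ?thesis using True by (simp add: power_mult_distrib)
  next
    case False
    then have "b = 0" using sum_squares_eq_4_power[OF ab] by simp
    then have "z * 2 ^ k = of_int a" using z by (simp add: complex_eq_iff)
    then show ?thesis using \<open>b = 0\<close> by simp
  qed
  also have "\<dots> = (4 ^ k) ^ 2" by (simp add: ab)
  also have "\<dots> = (2 ^ k) ^ 4" 
    using power_mult[of "2 :: complex" 2 "k * 2"] by (simp flip: power_mult) (simp add: mult.commute)
  finally show ?thesis by (simp add: power_mult_distrib)
qed

text \<open>Comparison of 2-adic valuations; this is how the irrationality of the square root of 2
  enters for odd \<open>f\<close>.\<close>

lemma square_eq_2_power_imp_even:
  fixes m :: int
  assumes "m ^ 2 = 2 ^ j"
  shows "even j"
proof -
  have "multiplicity 2 (m ^ 2) = 2 * multiplicity 2 m"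
    by (rule prime_elem_multiplicity_power_distrib) (use assms in auto)
  moreover have "multiplicity 2 (2 ^ j :: int) = j"
    by (rule multiplicity_same_power) auto
  ultimately show ?thesis using assms by simp
qed

section \<open>Adjoints, unitary matrices and almost dyadic matrices\<close>

definition adj :: "(complex, 'n :: finite) sqmat \<Rightarrow> (complex, 'n) sqmat" where
  "adj A = (\<chi> i j. cnj (A $ j $ i))"

lemma adj_nth [simp]: "adj A $ i $ j = cnj (A $ j $ i)"
  by (simp add: adj_def)

lemma adj_adj [simp]: "adj (adj A) = A"
  by (simp add: vec_eq_iff)

lemma adj_mult: "adj (A ** B) = adj B ** adj A"
  by (simp add: vec_eq_iff matrix_matrix_mult_def mult.commute)

definition unitary :: "(complex, 'n :: finite) sqmat \<Rightarrow> bool" where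
  "unitary A \<longleftrightarrow> adj A ** A = mat 1"

lemma unitary_right: "unitary A \<Longrightarrow> A ** adj A = mat 1"
  by (simp add: unitary_def matrix_left_right_inverse)

lemma unitary_adj: "unitary A \<Longrightarrow> unitary (adj A)"
  using unitary_right by (simp add: unitary_def)

lemma unitary_mult: "unitary A \<Longrightarrow> unitary B \<Longrightarrow> unitary (A ** B)"
  unfolding unitary_def adj_mult by (metis matrix_mul_assoc matrix_mul_lid)

lemma unitary_invertible: "unitary A \<Longrightarrow> invertible A"
  using unitary_right unfolding unitary_def invertible_def by blast

text \<open>Replaces group inverses by adjoints, whose entries are under control.\<close>

lemma inv_GL:
  fixes A :: "(complex, 'n :: finite) sqmat"
  assumes "unitary A"
  shows "inv\<^bsub>GL\<^esub> A = adj A"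
proof -
  interpret group "GL :: ((complex, 'n) sqmat) monoid" by (rule group_GL)
  show ?thesis
    using assms unitary_adj[OF assms] unitary_invertible
    by (intro inv_equality) (auto simp: GL_def unitary_def)
qed

text \<open>For odd \<open>f\<close> the factor \<open>c\<close> absorbs the \<open>\<surd>2\<close> in the entries of \<open>h_gen\<close>.\<close>

definition almost_dyadic :: "nat \<Rightarrow> (complex, 'n :: finite) sqmat \<Rightarrow> bool" where
  "almost_dyadic n A \<longleftrightarrow> (\<exists>c. c ^ n = 1 \<and> (\<forall>i j. c * A $ i $ j \<in> dyadic_gaussian))"

lemma almost_dyadic_mult:
  assumes "almost_dyadic n A" "almost_dyadic n B"
  shows "almost_dyadic n (A ** B)"
proof -
  obtain c d where "c ^ n = 1" "\<And>i j. c * A $ i $ j \<in> dyadic_gaussian"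
    "d ^ n = 1" "\<And>i j. d * B $ i $ j \<in> dyadic_gaussian"
    using assms unfolding almost_dyadic_def by blast
  moreover have "c * d * (A ** B) $ i $ j = (\<Sum>k\<in>UNIV. (c * A $ i $ k) * (d * B $ k $ j))" for i j
    by (simp add: matrix_matrix_mult_def sum_distrib_left mult_ac)
  ultimately show ?thesis
    unfolding almost_dyadic_def
    by (intro exI[of _ "c * d"]) (simp add: power_mult_distrib dyadic_gaussian_sum dyadic_gaussian_mult)
qed

lemma almost_dyadic_adj:
  assumes "almost_dyadic n A"
  shows "almost_dyadic n (adj A)"
proof -
  obtain c where c: "c ^ n = 1" "\<And>i j. c * A $ i $ j \<in> dyadic_gaussian"
    using assms unfolding almost_dyadic_def by blast
  have "cnj c ^ n = 1" using c(1) by (metis complex_cnj_one complex_cnj_power)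
  moreover have "cnj c * adj A $ i $ j \<in> dyadic_gaussian" for i j
    using dyadic_gaussian_cnj[OF c(2)[of j i]] by simp
  ultimately show ?thesis unfolding almost_dyadic_def by blast
qed

lemma almost_dyadic_1I: "(\<And>i j. A $ i $ j \<in> dyadic_gaussian) \<Longrightarrow> almost_dyadic n A"
  unfolding almost_dyadic_def by (intro exI[of _ 1]) simp

context clifford_weil_setting
begin

section \<open>The generated group and the invariants of its elements\<close>

definition zord :: nat where
  "zord = (if even f then 4 else 8)"

definition gens :: "(complex, 'a) sqmat set" where
  "gens = {h_gen f} \<union> {m_gen r | r. r \<noteq> 0} \<union> {d_gen f b r | r. r \<noteq> 0}"

definition G :: "(complex, 'a) sqmat set" where
  "G = generate GL gens"

lemma chi_dyadic [simp]: "chi x \<in> dyadic_gaussian"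
  using chi_cases[of x] by auto

lemma i_phi_dyadic [simp]: "i_phi x \<in> dyadic_gaussian"
  by (simp add: i_phi_def dyadic_gaussian_power)

lemma cnj_kappa [simp]: "cnj kappa = kappa"
  by (simp add: kappa_def)

lemma kappa_square: "kappa * kappa = 1 / 2 ^ f"
  by (simp add: kappa_def powr_minus powr_realpow field_simps flip: of_real_mult powr_add)

lemma cnj_i_phi: "cnj (i_phi x) * i_phi x = 1"
  by (simp add: i_phi_def flip: power_mult_distrib)

lemma unitary_gens: "A \<in> gens \<Longrightarrow> unitary A"
proof -
  assume "A \<in> gens"
  then consider "A = h_gen f" | r where "r \<noteq> 0" "A = m_gen r" | r where "A = d_gen f b r"
    by (auto simp: gens_def)
  then show ?thesis
  proof cases
    case 1
    \<comment> \<open>The inner product of columns \<open>i\<close> and \<open>j\<close> is a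
      character sum for \<open>i + j\<close>, which is zero exactly when \<open>i = j\<close> in
      characteristic 2.\<close>
    have "(\<Sum>k\<in>UNIV. cnj (kappa * chi (i * k)) * (kappa * chi (j * k))) = (if i = j then 1 else 0)" for i j
    proof -
      have "(\<Sum>k\<in>UNIV. cnj (kappa * chi (i * k)) * (kappa * chi (j * k)))
          = (\<Sum>k\<in>UNIV. kappa * kappa * chi ((i + j) * k))"
        by (simp add: distrib_right distrib_left chi_add mult_ac)
      then show ?thesis
        by (simp only: kappa_square chi_orthogonality add_eq_0 flip: sum_distrib_left) simp
    qed
    then show ?thesis
      unfolding 1 unitary_def by (simp add: vec_eq_iff matrix_matrix_mult_def h_gen_nth mat_def)
  next
    case 2
    then show ?thesis
      by (auto simp: unitary_def vec_eq_iff matrix_matrix_mult_def m_gen_nth mat_def if_distrib[of cnj]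
          if_distrib[of "\<lambda>x. x * _"] cong: if_cong)
  next
    case 3
    then show ?thesis
      by (auto simp: unitary_def vec_eq_iff matrix_matrix_mult_def d_gen_nth mat_def cnj_i_phi if_distrib[of cnj]
          if_distrib[of "\<lambda>x. x * _"] cong: if_cong)
  qed
qed

lemma almost_dyadic_h_gen: "almost_dyadic zord (h_gen f :: (complex, 'a) sqmat)"
proof (cases "even f")
  case True
  then obtain k where k: "f = 2 * k" by (rule evenE)
  have "2 powr (- real f / 2) * 2 ^ k = 2 powr (- real f / 2 + real k)"
    by (subst powr_add, subst powr_realpow) simp_all
  also have "- real f / 2 + real k = 0" by (simp add: k)
  finally have "complex_of_real (2 powr (- real f / 2) * 2 ^ k) = of_real 1"
    by (simp only: powr_zero_eq_one) simp
  then have "kappa * 2 ^ k = Complex (of_int 1) (of_int 0)"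
    by (simp only: kappa_def of_real_mult of_real_power of_real_numeral) (simp add: complex_eq_iff)
  then have "kappa \<in> dyadic_gaussian"
    by (rule dyadic_gaussianI)
  then show ?thesis by (intro almost_dyadic_1I) (simp add: h_gen_nth dyadic_gaussian_mult)
next
  case False
  then obtain k where k: "f = 2 * k + 1" by (rule oddE)
  have "2 powr (- real f / 2) * 2 ^ (k + 1) = 2 powr (- real f / 2 + real (k + 1))"
    by (subst powr_add, subst powr_realpow) simp_all
  also have "- real f / 2 + real (k + 1) = 1 / 2" by (simp add: k field_simps)
  finally have "complex_of_real (2 powr (- real f / 2) * 2 ^ (k + 1)) = of_real (sqrt 2)"
    by (simp only: powr_half_sqrt zero_le_numeral)
  then have "kappa * 2 ^ (k + 1) = of_real (sqrt 2)"
    by (simp only: kappa_def of_real_mult of_real_power of_real_numeral)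
  \<comment> \<open>A primitive eighth root of unity times the square root of 2 is
    \<open>1 + \<i>\<close>, a Gaussian integer.\<close>
  then have "cis (pi / 4) * kappa * 2 ^ (k + 1) = cis (pi / 4) * of_real (sqrt 2)"
    by (simp only: mult.assoc)
  also have "\<dots> = Complex (of_int 1) (of_int 1)"
    by (simp add: complex_eq_iff cos_45 sin_45)
  finally have dyadic: "cis (pi / 4) * kappa \<in> dyadic_gaussian"
    by (rule dyadic_gaussianI)
  have "cis (pi / 4) * h_gen f $ i $ j \<in> dyadic_gaussian" for i j :: 'a
    using dyadic_gaussian_mult[OF dyadic chi_dyadic[of "j * i"]] by (simp add: h_gen_nth mult.assoc)
  moreover have "cis (pi / 4) ^ zord = 1"
    using False by (simp add: Complex.DeMoivre zord_def)
  ultimately show ?thesis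
    unfolding almost_dyadic_def by blast
qed

lemma almost_dyadic_gens: "A \<in> gens \<Longrightarrow> almost_dyadic zord A"
  by (auto simp: gens_def m_gen_nth d_gen_nth almost_dyadic_h_gen intro: almost_dyadic_1I)

text \<open>The matrix \<open>mat2 0 1 1 0\<close> of \<open>h_gen\<close> has determinant
  \<open>- 1\<close>, which is 1 in characteristic 2.\<close>

lemma acts_gens:
  assumes "A \<in> gens"
  shows "\<exists>g. det g = 1 \<and> acts A g"
proof -
  have det: "det (mat2 x y z w) = x * w - y * z" for x y z w :: 'a
    by (simp add: det_2)
  consider "A = h_gen f" | r where "r \<noteq> 0" "A = m_gen r" | r where "A = d_gen f b r"
    using assms by (auto simp: gens_def)
  then show ?thesis
  proof cases
    case 1
    then show ?thesis using acts_h_gen by (intro exI[of _ "mat2 0 1 1 0"]) (simp add: det minus_eq)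
  next
    case (2 r)
    then show ?thesis
      using acts_m_gen[of r] by (intro exI[of _ "mat2 r 0 0 (1 / r)"]) (simp add: det)
  next
    case (3 r)
    then show ?thesis
      using acts_d_gen[of r] by (intro exI[of _ "mat2 1 0 (r * r) 1"]) (simp add: det)
  qed
qed

lemma G_mult: "A \<in> G \<Longrightarrow> B \<in> G \<Longrightarrow> A ** B \<in> G"
  unfolding G_def using generate.eng[of A GL gens B] by (simp add: GL_def)

lemma gens_carrier: "gens \<subseteq> carrier GL"
  using unitary_gens unitary_invertible by (auto simp: GL_def)

lemma mat_1_G: "mat 1 \<in> G"
  unfolding G_def using generate.one[of GL gens] by (simp add: GL_def)

lemma gens_G: "A \<in> gens \<Longrightarrow> A \<in> G"
  unfolding G_def by (rule generate.incl)

text \<open>The generators are unitary, so the case of inverses can be stated with adjoints.\<close>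

lemma G_induct [consumes 1, case_names one gen adj mult]:
  assumes "A \<in> G" "P (mat 1)" "\<And>A. A \<in> gens \<Longrightarrow> P A" "\<And>A. A \<in> gens \<Longrightarrow> P (adj A)"
    "\<And>A B. A \<in> G \<Longrightarrow> B \<in> G \<Longrightarrow> P A \<Longrightarrow> P B \<Longrightarrow> P (A ** B)"
  shows "P A"
  using assms(1) unfolding G_def
proof (induction rule: generate.induct)
  case one
  then show ?case using assms(2) by (simp add: GL_def)
next
  case (incl h)
  then show ?case by (rule assms(3))
next
  case (inv h)
  then show ?case using assms(4) by (simp add: inv_GL unitary_gens)
next
  case (eng h1 h2)
  then show ?case using assms(5) by (simp add: GL_def G_def)
qed

lemma unitary_G: "A \<in> G \<Longrightarrow> unitary A"
proof (induction rule: G_induct)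
  case one
  show ?case by (simp add: unitary_def vec_eq_iff mat_def matrix_matrix_mult_def if_distrib[of "\<lambda>x. x * _"] if_distrib[of cnj] cong: if_cong)
qed (simp_all add: unitary_gens unitary_adj unitary_mult)

lemma adj_G: "A \<in> G \<Longrightarrow> adj A \<in> G"
proof -
  interpret GL: group "GL :: ((complex, 'a) sqmat) monoid" by (rule group_GL)
  assume A: "A \<in> G"
  then have "inv\<^bsub>GL\<^esub> A \<in> G"
    unfolding G_def using GL.generate_m_inv_closed[OF gens_carrier] by blast
  then show "adj A \<in> G" by (simp add: inv_GL unitary_G A)
qed

lemma almost_dyadic_G: "A \<in> G \<Longrightarrow> almost_dyadic zord A"
  by (induction rule: G_induct)
    (simp_all add: almost_dyadic_gens almost_dyadic_adj almost_dyadic_mult almost_dyadic_1I mat_def)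

lemma acts_G: "A \<in> G \<Longrightarrow> \<exists>g. det g = 1 \<and> acts A g"
proof (induction rule: G_induct)
  case one
  then show ?case using acts_mat_1 by (intro exI[of _ "mat 1"]) simp
next
  case (gen A)
  then show ?case by (rule acts_gens)
next
  case (adj A)
  then obtain g where g: "det g = 1" "acts A g" using acts_gens by blast
  then have "invertible g" by (simp add: invertible_det_nz)
  then obtain h where h: "g ** h = mat 1" by (auto simp: invertible_def)
  then have "det (g ** h) = 1" by (simp only: det_I)
  then have "det h = 1" using g(1) by (simp add: det_mul)
  moreover have "acts (adj A) h"
    using acts_inverse[OF g(2) unitary_right _ h] unitary_gens[OF adj] by (simp add: unitary_def)
  ultimately show ?case by blast
next
  case (mult A B)
  then obtain g h where "det g = 1" "acts A g" "det h = 1" "acts B h" by blast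
  then show ?case by (intro exI[of _ "g ** h"]) (simp add: acts_mult det_mul)
qed

text \<open>Column 0 has the single nonzero entry \<open>c\<close>. Unitarity gives \<open>c\<close>
  absolute value 1, and \<open>almost_dyadic_G\<close> puts \<open>e * c\<close> into Z[i, 1/2] for
  a root of unity \<open>e\<close>; hence \<open>(e * c) ^ 4 = 1\<close>, and 4 divides
  \<open>zord\<close>.\<close>

lemma scalar_G:
  assumes "mat c ** W s t \<in> G"
  shows "c ^ zord = 1"
proof -
  let ?A = "mat c ** W s t"
  have "(\<Sum>k\<in>UNIV. cnj (?A $ k $ 0) * ?A $ k $ 0) = (mat 1 :: (complex, 'a) sqmat) $ 0 $ 0"
    using unitary_G[OF assms] unfolding unitary_def
    by (simp add: matrix_matrix_mult_def[of "adj ?A"] vec_eq_iff)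
  then have "cnj c * c = 1"
    by (simp add: mat_mult_nth W_nth if_distrib[of "\<lambda>x. _ * x"] if_distrib[of cnj] cong: if_cong)
      (simp add: mat_def)
  then have "of_real ((norm c) ^ 2) = (1 :: complex)"
    by (simp only: complex_norm_square mult.commute)
  then have nc: "norm c = 1"
    using norm_ge_zero[of c] unfolding of_real_eq_1_iff by (auto simp: power2_eq_1_iff)
  obtain e where e: "e ^ zord = 1" "e * ?A $ s $ 0 \<in> dyadic_gaussian"
    using almost_dyadic_G[OF assms] unfolding almost_dyadic_def by blast
  have ec: "e * c \<in> dyadic_gaussian"
    using e(2) by (simp add: mat_mult_nth W_nth)
  have "norm e = 1"
    using power_eq_1_iff[OF e(1)] by (simp add: zord_def split: if_splits)
  then have "(e * c) ^ 4 = 1"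
    using ec nc by (intro dyadic_gaussian_norm_1) (simp_all add: norm_mult)
  then have "(e * c) ^ (4 * (zord div 4)) = 1" by (simp only: power_mult power_one)
  moreover have "4 * (zord div 4) = zord" by (simp add: zord_def)
  ultimately show ?thesis using e(1) by (simp add: power_mult_distrib)
qed

lemma acts_trivially_G:
  assumes "A \<in> G" "acts A (mat 1)"
  shows "\<exists>c s t. c ^ zord = 1 \<and> A = mat c ** W s t"
proof -
  have "(adj A ** A) $ 0 $ 0 = (mat 1 :: (complex, 'a) sqmat) $ 0 $ 0"
    using unitary_G[OF assms(1)] by (simp add: unitary_def)
  then have "A \<noteq> 0"
    by (auto simp: matrix_matrix_mult_def mat_def)
  from acts_trivially_imp_W[OF assms(2) this] show ?thesis
    using scalar_G assms(1) by blast
qed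

end

section \<open>The extension\<close>

lemma group_additive: "group (additive_group :: 'k :: ab_group_add monoid)"
proof (rule groupI)
  fix x :: 'k
  show "\<exists>y\<in>carrier additive_group. y \<otimes>\<^bsub>additive_group\<^esub> x = \<one>\<^bsub>additive_group\<^esub>"
    by (rule bexI[of _ "- x"]) (simp_all add: additive_group_def)
qed (simp_all add: additive_group_def add.assoc)

lemma group_SL2: "group (SL2 :: (('k :: field, 2) sqmat) monoid)"
proof (rule groupI)
  fix A :: "('k, 2) sqmat"
  assume "A \<in> carrier SL2"
  then have A: "det A = 1" by (simp add: SL2_def)
  then have "invertible A" by (simp add: invertible_det_nz)
  then obtain B where B: "B ** A = mat 1" by (auto simp: invertible_def)
  then have "det (B ** A) = 1" by (simp only: det_I)
  then have "det B = 1" using A by (simp add: det_mul)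
  then show "\<exists>B\<in>carrier SL2. B \<otimes>\<^bsub>SL2\<^esub> A = \<one>\<^bsub>SL2\<^esub>"
    using B by (auto simp: SL2_def)
qed (auto simp: SL2_def det_mul matrix_mul_assoc)

lemma roots_of_unity_iso:
  assumes "n > 0"
  shows "(\<lambda>k. cis (2 * pi * real_of_int k / real n)) \<in>
    iso (integer_mod_group n) \<lparr>carrier = {z. z ^ n = 1}, monoid.mult = (*), one = 1\<rparr>"
proof (rule isoI)
  let ?e = "\<lambda>k :: int. cis (2 * pi * real_of_int k / real n)"
  have period: "?e (k mod int n) = ?e k" for k
  proof -
    have "?e (a + int n * q) = ?e a * cis (2 * pi * real_of_int q)" for a q
      using assms by (simp add: cis_mult field_simps)
    from this[of "k mod int n" "k div int n"]
    have "?e k = ?e (k mod int n) * cis (2 * pi * real_of_int (k div int n))"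
      by (simp only: mod_mult_div_eq)
    also have "cis (2 * pi * real_of_int (k div int n)) = 1"
      by (rule cis_multiple_2pi) simp
    finally show ?thesis by simp
  qed
  have add: "?e (k + l) = ?e k * ?e l" for k l
    by (simp add: cis_mult add_divide_distrib distrib_left)
  have add_mod: "?e ((k + l) mod int n) = ?e k * ?e l" for k l
    by (simp only: period add)
  have bij: "bij_betw (\<lambda>k :: nat. ?e (int k)) {..<n} {z. z ^ n = 1}"
    using Complex.bij_betw_roots_unity[OF assms] by simp
  \<comment> \<open>The roots are enumerated by natural numbers below \<open>n\<close>, whereas the
    carrier of \<open>integer_mod_group n\<close> consists of integers.\<close>
  have "bij_betw nat {0..<int n} {..<n}"
    by (rule bij_betwI[of _ _ _ int]) auto
  from bij_betw_trans[OF this bij] have "bij_betw (\<lambda>k. ?e (int (nat k))) {0..<int n} {z. z ^ n = 1}"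
    by (simp only: o_def)
  also have "?this \<longleftrightarrow> bij_betw ?e {0..<int n} {z. z ^ n = 1}"
    by (rule bij_betw_cong) simp
  finally have b: "bij_betw ?e {0..<int n} {z. z ^ n = 1}" .
  then show "bij_betw ?e (carrier (integer_mod_group n))
      (carrier \<lparr>carrier = {z. z ^ n = 1}, monoid.mult = (*), one = 1\<rparr>)"
    using assms by (simp add: carrier_integer_mod_group)
  show "?e \<in> hom (integer_mod_group n) \<lparr>carrier = {z. z ^ n = 1}, monoid.mult = (*), one = 1\<rparr>"
    using assms bij_betwE[OF b] by (auto intro!: homI simp: carrier_integer_mod_group add_mod)
qed

text \<open>Fourth powers of eighth roots of unity are signs, and \<open>c\<close> has sign
  \<open>- 1\<close>; so the fourth roots of unity and a single further scalar give all eighth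
  roots.\<close>

lemma eighth_roots_of_unity_cosets:
  fixes c d :: complex
  assumes "c ^ 8 = 1" "c ^ 4 \<noteq> 1" "d ^ 8 = 1"
  shows "d ^ 4 = 1 \<or> (d * c) ^ 4 = 1"
proof -
  have "c ^ 4 * c ^ 4 = 1" "d ^ 4 * d ^ 4 = 1"
    using assms by (simp_all flip: power_add)
  then have "c ^ 4 = - 1" "d ^ 4 = 1 \<or> d ^ 4 = - 1"
    using assms(2) unfolding square_eq_1_iff by blast+
  then show ?thesis by (auto simp: power_mult_distrib)
qed

lemma pow4_eq_1_cases: "c ^ 4 = 1 \<Longrightarrow> c \<in> {1, \<i>, - 1, - \<i>}" for c :: complex
proof -
  assume "c ^ 4 = 1"
  moreover have "(c - 1) * (c + 1) * (c - \<i>) * (c + \<i>) = c ^ 4 - 1"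
    by (simp add: algebra_simps power4_eq_xxxx)
  ultimately show ?thesis by (auto simp: eq_neg_iff_add_eq_0)
qed

text \<open>Since \<open>c ^ 3\<close> inverts \<open>c\<close>, the real number
  \<open>z * c ^ 3\<close> is the inverse of \<open>k * k * k\<close> and lies in Z[i, 1/2]. Its
  square is \<open>2 ^ (3 * f)\<close>, impossible for an odd exponent.\<close>

lemma odd_half_power_not_dyadic:
  fixes k :: real
  assumes "odd f" "k * k = 1 / 2 ^ f" "of_real (k * k * k) * z = c" "z \<in> dyadic_gaussian" "c ^ 4 = 1"
  shows False
proof -
  define y where "y = inverse (k * k * k)"
  have "of_real (k * k * k) * (z * c ^ 3) = c * c ^ 3"
    unfolding assms(3)[symmetric] by (simp only: mult.assoc)
  also have "\<dots> = 1" using assms(5) by (simp flip: power_Suc)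
  finally have "z * c ^ 3 = of_real y"
    unfolding y_def of_real_inverse by (rule inverse_unique[symmetric])
  moreover have "c \<in> dyadic_gaussian"
    using pow4_eq_1_cases[OF assms(5)] dyadic_gaussian_mult[of "- 1" \<i>] by auto
  ultimately have "of_real y \<in> dyadic_gaussian"
    using dyadic_gaussian_mult[OF assms(4) dyadic_gaussian_power[of c 3]] by simp
  then obtain a b l where "of_real y * 2 ^ l = Complex (of_int a) (of_int b)"
    unfolding dyadic_gaussian_def by blast
  then have "of_real (y * 2 ^ l) = Complex (of_int a) (of_int b)"
    by (simp only: of_real_mult of_real_power of_real_numeral)
  from arg_cong[OF this, of Re] have a: "y * 2 ^ l = of_int a"
    by (simp only: Re_complex_of_real complex.sel)
  have "y ^ 2 = inverse ((k * k) * (k * k) * (k * k))"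
    by (simp add: y_def power2_eq_square mult_ac)
  also have "\<dots> = 2 ^ (3 * f)"
    unfolding assms(2) mult.commute[of 3 f] power_mult by (simp add: power3_eq_cube)
  finally have "(y * 2 ^ l) ^ 2 = 2 ^ (3 * f + 2 * l)"
    unfolding power_mult_distrib power_add mult.commute[of 2 l] power_mult by simp
  then have "of_int (a ^ 2) = (of_int (2 ^ (3 * f + 2 * l)) :: real)"
    by (simp add: a)
  then have "a ^ 2 = 2 ^ (3 * f + 2 * l)" by (simp only: of_int_eq_iff)
  from square_eq_2_power_imp_even[OF this] show False using assms(1) by simp
qed

context clifford_weil_setting
begin

section \<open>Pauli matrices and scalars inside the group\<close>

lemma h_gen_G: "h_gen f \<in> G" and m_gen_G: "r \<noteq> 0 \<Longrightarrow> m_gen r \<in> G"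
  and d_gen_G: "r \<noteq> 0 \<Longrightarrow> d_gen f b r \<in> G"
  by (auto intro!: gens_G simp: gens_def)

lemma cancel_right: "unitary B \<Longrightarrow> A ** B = C \<Longrightarrow> A = C ** adj B"
  by (auto simp: unitary_right simp flip: matrix_mul_assoc)

text \<open>Diagonal Pauli matrices are squares of the \<open>d_gen\<close>, by
  \<open>i_phi_square\<close>.\<close>

lemma W_0_G: "W 0 t \<in> G"
proof (cases "t = 0")
  case True
  then show ?thesis by (simp add: W_0_0 mat_1_G)
next
  case False
  have "d_gen f b t ** d_gen f b t = W 0 t"
    by (simp add: vec_eq_iff matrix_matrix_mult_def d_gen_nth W_nth i_phi_square mult.commute
        if_distrib[of "\<lambda>x. x * _"] cong: if_cong)
  then show ?thesis using G_mult[OF d_gen_G[OF False] d_gen_G[OF False]] by simp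
qed

text \<open>Conjugation by \<open>h_gen\<close> turns diagonal Pauli matrices into shifts.\<close>

lemma W_G: "W s t \<in> G"
proof -
  have "W s 0 ** h_gen f = h_gen f ** W 0 s"
    using h_gen_W[of 0 s] by simp
  then have "W s 0 = h_gen f ** W 0 s ** adj (h_gen f)"
    by (rule cancel_right[OF unitary_G[OF h_gen_G]])
  then have "W s 0 \<in> G" by (simp add: G_mult h_gen_G W_0_G adj_G)
  moreover have "W s t = W s 0 ** W 0 t" by (simp add: W_mult_W)
  ultimately show ?thesis by (simp add: G_mult W_0_G)
qed

lemma scalar_GI:
  assumes "mat c ** A \<in> G" "A \<in> G"
  shows "mat c \<in> G"
  using cancel_right[OF unitary_G[OF assms(2)], OF refl] assms by (metis G_mult adj_G)

lemma mat_i_G: "mat \<i> \<in> G"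
proof -
  \<comment> \<open>Chosen because \<open>i_phi\<close> takes the value \<open>\<i>\<close> there,
    so the intertwining scalar of \<open>d_gen f b 1\<close> is \<open>\<i>\<close>.\<close>
  let ?x = "b 1"
  have "d_gen f b 1 ** W ?x 0 = mat \<i> ** (W ?x ?x ** d_gen f b 1)"
    using d_gen_W[of 1 ?x 0] by (simp only: mult_1_right mult_1_left add_0 i_phi_basis)
  then have "mat \<i> ** (W ?x ?x ** d_gen f b 1) \<in> G"
    using G_mult[OF d_gen_G W_G] by (metis one_neq_zero)
  then show ?thesis by (rule scalar_GI) (simp add: G_mult W_G d_gen_G)
qed

lemma mat_pow4_G: "c ^ 4 = 1 \<Longrightarrow> mat c \<in> G"
proof -
  assume "c ^ 4 = 1"
  then have "c \<in> {1, \<i>, - 1, - \<i>}" by (rule pow4_eq_1_cases)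
  moreover have "mat (- 1) \<in> G" using G_mult[OF mat_i_G mat_i_G] by (simp add: mat_mult_mat)
  ultimately show ?thesis
    using mat_1_G mat_i_G G_mult[of "mat (- 1)" "mat \<i>"] by (auto simp: mat_mult_mat)
qed

text \<open>For odd \<open>f\<close>, the element \<open>(h d\<^sub>1)\<^sup>3\<close> acts trivially, so it is a scalar times some \<open>W s t\<close>;
  its entries lie in \<open>2 powr (- 3 * f / 2) \<cdot> \<int>[\<i>]\<close>, so the scalar cannot be a power of \<open>\<i>\<close>.\<close>

lemma primitive_scalar_G:
  assumes "odd f"
  shows "\<exists>c. c ^ 8 = 1 \<and> c ^ 4 \<noteq> 1 \<and> mat c \<in> G"
proof -
  define B :: "(complex, 'a) sqmat" where "B = h_gen f ** d_gen f b 1"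
  have BG: "B \<in> G" by (simp add: B_def G_mult h_gen_G d_gen_G)
  let ?g = "mat2 0 1 1 0 ** mat2 1 0 (1 * 1) (1 :: 'a)"
  have "acts B ?g"
    unfolding B_def by (rule acts_mult[OF acts_h_gen acts_d_gen])
  then have "acts (B ** B ** B) (?g ** ?g ** ?g)"
    by (intro acts_mult)
  \<comment> \<open>\<open>?g\<close> has rows \<open>(1, 1)\<close> and \<open>(1, 0)\<close>, an
    element of order 3 in characteristic 2.\<close>
  moreover have "?g ** ?g ** ?g = mat 1"
    by (simp add: vec_eq_iff forall_2 matrix_matrix_mult_def sum_2)
  ultimately obtain c s t where c: "c ^ zord = 1" "B ** B ** B = mat c ** W s t"
    using acts_trivially_G[of "B ** B ** B"] BG G_mult by metis
  have "mat c \<in> G"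
    using scalar_GI[OF _ W_G, of c s t] c(2) BG G_mult by metis
  moreover have "c ^ 8 = 1" using c(1) assms by (simp add: zord_def)
  moreover have False if "c ^ 4 = 1"
  proof -
    \<comment> \<open>The entry of \<open>B ** B ** B\<close> in row \<open>s\<close> and column 0,
      with the three factors \<open>kappa\<close> removed; \<open>W s t\<close> has entry 1
      there.\<close>
    define z where "z = (\<Sum>k\<in>UNIV. (\<Sum>l\<in>UNIV. (chi (l * s) * i_phi l) * (chi (k * l) * i_phi k)) * (chi (0 * k) * i_phi 0))"
    have B_nth: "B $ i $ j = kappa * (chi (j * i) * i_phi j)" for i j
      by (simp add: B_def matrix_matrix_mult_def h_gen_nth d_gen_nth mult.assoc
          if_distrib[of "\<lambda>x. _ * x"] cong: if_cong)
    have "c = (B ** B ** B) $ s $ 0"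
      by (simp add: c(2) mat_mult_nth W_nth)
    also have "\<dots> = kappa * kappa * kappa * z"
      by (simp add: z_def matrix_matrix_mult_def B_nth sum_distrib_left sum_distrib_right mult_ac)
    finally have "of_real (Re kappa * Re kappa * Re kappa) * z = c"
      by (simp add: kappa_def)
    moreover have "Re kappa * Re kappa = 1 / 2 ^ f"
      by (simp add: kappa_def powr_minus powr_realpow field_simps flip: powr_add)
    moreover have "z \<in> dyadic_gaussian"
      unfolding z_def by (intro dyadic_gaussian_sum dyadic_gaussian_mult chi_dyadic i_phi_dyadic)
    ultimately show False
      using odd_half_power_not_dyadic[OF assms] that by blast
  qed
  ultimately show ?thesis by blast
qed

lemma mat_G: "c ^ zord = 1 \<Longrightarrow> mat c \<in> G"
proof (cases "even f")
  case True
  then show "c ^ zord = 1 \<Longrightarrow> mat c \<in> G" by (simp add: zord_def mat_pow4_G)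
next
  case False
  assume "c ^ zord = 1"
  with False have c: "c ^ 8 = 1" by (simp add: zord_def)
  obtain d where d: "d ^ 8 = 1" "d ^ 4 \<noteq> 1" "mat d \<in> G"
    using primitive_scalar_G False by blast
  from eighth_roots_of_unity_cosets[OF d(1,2) c] show "mat c \<in> G"
  proof
    assume "(c * d) ^ 4 = 1"
    then have "mat (c * d) \<in> G" by (rule mat_pow4_G)
    then show ?thesis using scalar_GI[OF _ d(3), of c] by (simp add: mat_mult_mat)
  qed (rule mat_pow4_G)
qed

section \<open>Surjectivity onto the special linear group\<close>

lemma acts_surj:
  assumes "det g = 1"
  shows "\<exists>A\<in>G. acts A g"
proof -
  define H where "H = {g. \<exists>A\<in>G. acts A g}"
  have mult: "g ** h \<in> H" if "g \<in> H" "h \<in> H" for g h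
    using that acts_mult G_mult unfolding H_def by blast
  have swap: "mat2 0 1 1 0 \<in> H"
    unfolding H_def using h_gen_G acts_h_gen by blast
  have diag: "mat2 r 0 0 (1 / r) \<in> H" if "r \<noteq> 0" for r
    unfolding H_def using m_gen_G acts_m_gen that by blast
  have eq: "g = mat2 (g $ 1 $ 1) (g $ 1 $ 2) (g $ 2 $ 1) (g $ 2 $ 2)" for g :: "'a ^ 2 ^ 2"
    by (simp add: vec_eq_iff forall_2)
  have mat2_mult: "mat2 x y z w ** mat2 x' y' z' w'
      = mat2 (x * x' + y * z') (x * y' + y * w') (z * x' + w * z') (z * y' + w * w')"
    for x y z w x' y' z' w' :: 'a
    by (simp add: vec_eq_iff forall_2 matrix_matrix_mult_def sum_2)
  have lower: "mat2 1 0 x 1 \<in> H" for x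
  proof (cases "x = 0")
    case True
    then show ?thesis using diag[of 1] by simp
  next
    case False
    \<comment> \<open>The square root of \<open>x\<close>, as \<open>x ^ (2 ^ f) = x\<close>;
      \<open>d_gen f b y\<close> then acts by the elementary matrix with entry
      \<open>x\<close>.\<close>
    define y where "y = x ^ (2 ^ (f - 1))"
    have "2 ^ (f - 1) + 2 ^ (f - 1) = (2 ^ f :: nat)"
      using f_pos by (cases f) simp_all
    then have "y * y = x"
      using field_power_card[OF card_field, of x] by (simp only: y_def power_add[symmetric])
    moreover from this have "y \<noteq> 0" using False by auto
    ultimately show ?thesis
      unfolding H_def using d_gen_G[of y] acts_d_gen[of y] by (auto intro!: bexI[of _ "d_gen f b y"])
  qed
  have upper: "mat2 1 x 0 1 \<in> H" for x
    using mult[OF mult[OF swap lower[of x]] swap] by (simp add: mat2_mult)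
  have generic: "g \<in> H" if "det g = 1" "g $ 1 $ 1 \<noteq> 0" for g
  proof -
    define p q u v where "p = g $ 1 $ 1" "q = g $ 1 $ 2" "u = g $ 2 $ 1" "v = g $ 2 $ 2"
    note defs = this
    have "p \<noteq> 0" and "p * v - q * u = 1"
      using that by (simp_all add: defs det_2)
    then have v: "(1 + q * u) / p = v" by (simp add: field_simps)
    \<comment> \<open>Gaussian elimination with the nonzero pivot \<open>p\<close>: lower
      unitriangular, diagonal, upper unitriangular.\<close>
    have "mat2 1 0 (u / p) 1 ** mat2 p 0 0 (1 / p) ** mat2 1 (q / p) 0 1 = mat2 p q u v"
      using \<open>p \<noteq> 0\<close> by (simp add: v mat2_mult field_simps)
    moreover have "mat2 p q u v = g" using eq[of g] by (simp add: defs)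
    ultimately show ?thesis
      using mult[OF mult[OF lower diag[OF \<open>p \<noteq> 0\<close>]] upper] by metis
  qed
  have "g \<in> H"
  proof (cases "g $ 1 $ 1 = 0")
    case False
    then show ?thesis using generic assms by blast
  next
    case True
    \<comment> \<open>With a zero pivot the lower left entry is nonzero, so exchanging the rows
      reduces to the generic case.\<close>
    let ?s = "mat2 0 1 1 0 :: 'a ^ 2 ^ 2"
    have "?s ** ?s = mat 1"
      by (simp add: vec_eq_iff forall_2 matrix_matrix_mult_def sum_2)
    then have g: "?s ** (?s ** g) = g" by (simp add: matrix_mul_assoc)
    have "det ?s = 1" by (simp add: det_2 minus_eq)
    then have "det (?s ** g) = 1" using assms by (simp add: det_mul)
    moreover have "(?s ** g) $ 1 $ 1 = g $ 2 $ 1"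
      by (simp add: matrix_matrix_mult_def sum_2)
    moreover have "g $ 2 $ 1 \<noteq> 0" using True assms by (auto simp: det_2)
    ultimately have "?s ** g \<in> H" by (intro generic) simp_all
    from mult[OF swap this] show ?thesis by (simp only: g)
  qed
  then show ?thesis by (simp add: H_def)
qed

section \<open>The normal subgroups and their quotients\<close>

abbreviation CW :: "(complex, 'a) sqmat monoid" where
  "CW \<equiv> clifford_weil f b"

lemma CW_eq: "CW = GL\<lparr>carrier := G\<rparr>"
  by (simp add: clifford_weil_def G_def gens_def)

lemma CW_simps [simp]: "carrier CW = G" "A \<otimes>\<^bsub>CW\<^esub> B = A ** B" "\<one>\<^bsub>CW\<^esub> = mat 1"
  by (simp_all add: CW_eq GL_def)

lemma group_CW: "group CW"
proof -
  interpret GL: group "GL :: ((complex, 'a) sqmat) monoid" by (rule group_GL)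
  show ?thesis
    unfolding CW_eq G_def
    by (rule subgroup.subgroup_is_group[OF GL.generate_is_subgroup[OF gens_carrier] group_GL])
qed

definition SL2_action :: "(complex, 'a) sqmat \<Rightarrow> 'a ^ 2 ^ 2" where
  "SL2_action A = (THE g. acts A g)"

lemma SL2_action_eq: "A \<in> G \<Longrightarrow> acts A g \<Longrightarrow> SL2_action A = g"
  unfolding SL2_action_def using acts_unique unitary_invertible[OF unitary_G] by blast

lemma SL2_action: "A \<in> G \<Longrightarrow> det (SL2_action A) = 1 \<and> acts A (SL2_action A)"
  using acts_G SL2_action_eq by metis

lemma SL2_action_hom: "group_hom CW SL2 SL2_action"
proof -
  have "SL2_action (A ** B) = SL2_action A ** SL2_action B" if "A \<in> G" "B \<in> G" for A B
    using that SL2_action acts_mult G_mult by (intro SL2_action_eq) blast+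
  then have "SL2_action \<in> hom CW SL2"
    using SL2_action by (auto intro!: homI simp: SL2_def)
  then show ?thesis
    by (simp add: group_hom_def group_hom_axioms_def group_CW group_SL2)
qed

definition Zc :: "(complex, 'a) sqmat set" where
  "Zc = {mat c | c. c ^ zord = 1}"

definition M :: "(complex, 'a) sqmat set" where
  "M = {mat c ** W s t | c s t. c ^ zord = 1}"

text \<open>One inclusion is \<open>acts_W\<close>, with \<open>mat_G\<close> and \<open>W_G\<close>
  placing \<open>M\<close> inside the group; the other is \<open>acts_trivially_G\<close>.\<close>

lemma M_eq_kernel: "M = kernel CW SL2 SL2_action"
proof -
  have "A \<in> G \<and> SL2_action A = mat 1" if "A \<in> M" for A
    using that SL2_action_eq acts_W mat_G W_G G_mult unfolding M_def by blast
  moreover have "A \<in> M" if "A \<in> G" "SL2_action A = mat 1" for A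
    using acts_trivially_G[of A] SL2_action[of A] that unfolding M_def by auto
  ultimately show ?thesis by (auto simp: kernel_def SL2_def)
qed

lemma CW_Mod_M: "CW Mod M \<cong> (SL2 :: ('a ^ 2 ^ 2) monoid)"
proof -
  interpret group_hom CW SL2 SL2_action by (rule SL2_action_hom)
  have "SL2_action ` G = {g. det g = 1}"
    using SL2_action acts_surj SL2_action_eq by (auto simp: image_iff) metis
  then show ?thesis
    unfolding M_eq_kernel by (intro FactGroup_iso) (simp add: SL2_def)
qed

lemma M_normal: "M \<lhd> CW"
  unfolding M_eq_kernel by (rule group_hom.normal_kernel[OF SL2_action_hom])

lemma zord_pos: "zord > 0"
  by (simp add: zord_def)

lemma root_nonzero: "c ^ zord = 1 \<Longrightarrow> c \<noteq> (0 :: complex)"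
  using zord_pos by (auto simp: power_0_left)

lemma mat_inj: "mat c = (mat d :: (complex, 'a) sqmat) \<longleftrightarrow> c = d"
  by (auto simp: vec_eq_iff mat_def)

lemma Z_iso: "CW\<lparr>carrier := Zc\<rparr> \<cong> integer_mod_group zord"
proof -
  let ?U = "\<lparr>carrier = {z :: complex. z ^ zord = 1}, monoid.mult = (*), one = 1\<rparr>"
  have "mat \<in> iso ?U (CW\<lparr>carrier := Zc\<rparr>)"
    by (rule isoI) (auto intro!: homI simp: Zc_def mat_mult_mat bij_betw_def inj_on_def mat_inj)
  then have "integer_mod_group zord \<cong> CW\<lparr>carrier := Zc\<rparr>"
    using roots_of_unity_iso[OF zord_pos] iso_set_trans unfolding is_iso_def by blast
  then show ?thesis
    by (rule group.iso_sym[OF group_integer_mod_group])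
qed

lemma Z_normal: "Zc \<lhd> CW"
proof -
  interpret CW: group CW by (rule group_CW)
  have "subgroup Zc CW"
  proof (rule CW.subgroupI)
    show "Zc \<subseteq> carrier CW" by (auto simp: Zc_def mat_G)
    show "Zc \<noteq> {}" unfolding Zc_def by (auto intro: exI[of _ 1])
    fix A B assume "A \<in> Zc" "B \<in> Zc"
    then show "A \<otimes>\<^bsub>CW\<^esub> B \<in> Zc"
      by (auto simp: Zc_def mat_mult_mat power_mult_distrib)
  next
    fix A assume "A \<in> Zc"
    then obtain c where c: "A = mat c" "c ^ zord = 1" by (auto simp: Zc_def)
    then have "c \<noteq> 0" using root_nonzero by blast
    then have "inv\<^bsub>CW\<^esub> A = mat (inverse c)"
      using c mat_G by (intro CW.inv_equality) (simp_all add: mat_mult_mat power_inverse)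
    then show "inv\<^bsub>CW\<^esub> A \<in> Zc" using c by (auto simp: Zc_def power_inverse)
  qed
  moreover have "Zc #>\<^bsub>CW\<^esub> A = A <#\<^bsub>CW\<^esub> Zc" for A
    by (auto simp: r_coset_def l_coset_def Zc_def mat_commute)
  ultimately show ?thesis by (intro CW.normalI) auto
qed

definition W_index :: "(complex, 'a) sqmat \<Rightarrow> 'a \<times> 'a" where
  "W_index A = (THE st. \<exists>c. c ^ zord = 1 \<and> A = mat c ** W (fst st) (snd st))"

lemma W_index: 
  assumes "c ^ zord = 1"
  shows "W_index (mat c ** W s t) = (s, t)"
proof -
  have "c \<noteq> 0" using assms by (rule root_nonzero)
  then show ?thesis
    unfolding W_index_def
    by (intro the_equality) (use assms in \<open>auto dest!: W_eq_iff\<close>)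
qed

lemma chi_zord: "chi x ^ zord = 1"
  using chi_cases[of x] by (auto simp: zord_def)

text \<open>Multiplication in \<open>M\<close> adds labels up to a sign, which the scalars absorb by
  \<open>chi_zord\<close>. So \<open>W_index\<close> is a homomorphism; its kernel consists of the
  multiples of \<open>W 0 0\<close>, the identity matrix.\<close>

lemma M_Mod_Z: "CW\<lparr>carrier := M\<rparr> Mod Zc \<cong> (additive_group :: 'a monoid) \<times>\<times> (additive_group :: 'a monoid)"
proof -
  let ?M = "CW\<lparr>carrier := M\<rparr>" and ?A = "(additive_group :: 'a monoid) \<times>\<times> additive_group"
  have gM: "group ?M"
    by (rule subgroup.subgroup_is_group[OF normal_imp_subgroup[OF M_normal] group_CW])
  have "W_index ((mat c ** W s t) ** (mat d ** W u v)) = (s + u, t + v)"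
    if "c ^ zord = 1" "d ^ zord = 1" for c d s t u v
  proof -
    have "(mat c ** W s t) ** (mat d ** W u v) = mat (c * (d * chi (t * u))) ** W (s + u) (t + v)"
      unfolding matrix_mul_assoc[symmetric] mat_left_commute[of "W s t"] W_mult_W mat_mat_mult ..
    then show ?thesis using W_index that by (simp add: power_mult_distrib chi_zord)
  qed
  then have "W_index \<in> hom ?M ?A"
    by (auto intro!: homI simp: M_def W_index additive_group_def)
  then interpret group_hom ?M ?A W_index
    by (simp add: group_hom_def group_hom_axioms_def gM DirProd_group group_additive)
  have "kernel ?M ?A W_index = Zc"
  proof -
    have "A \<in> Zc" if "A \<in> M" "W_index A = (0, 0)" for A
      using that W_index by (auto simp: M_def Zc_def W_0_0)
    moreover have "A \<in> M \<and> W_index A = (0, 0)" if A: "A \<in> Zc" for A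
    proof -
      obtain c where c: "c ^ zord = 1" "A = mat c ** W 0 0"
        using A by (auto simp: Zc_def W_0_0)
      then show ?thesis using W_index unfolding M_def by blast
    qed
    ultimately show ?thesis by (auto simp: kernel_def additive_group_def)
  qed
  moreover have "W_index ` M = UNIV"
  proof -
    have "st \<in> W_index ` M" for st
    proof (rule image_eqI)
      show "st = W_index (mat 1 ** W (fst st) (snd st))" by (subst W_index) simp_all
      show "mat 1 ** W (fst st) (snd st) \<in> M"
        unfolding M_def by (intro CollectI exI conjI, rule refl) simp
    qed
    then show ?thesis by blast
  qed
  ultimately show ?thesis
    using FactGroup_iso by (simp add: additive_group_def)
qed

lemma Z_subset_M: "Zc \<subseteq> M"
proof
  fix A assume "A \<in> Zc"
  then obtain c where "c ^ zord = 1" "A = mat c ** W 0 0"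
    by (auto simp: Zc_def W_0_0)
  then show "A \<in> M" unfolding M_def by blast
qed

end

theorem theorem16:
  fixes f :: nat and b :: "nat \<Rightarrow> 'a :: {field, finite}"
  assumes "f \<ge> 1" and "CARD('a) = 2 ^ f" and "self_complementary_basis f b"
  shows "\<exists>Z M. Z \<lhd> clifford_weil f b \<and> M \<lhd> clifford_weil f b \<and> Z \<subseteq> M
    \<and> (clifford_weil f b)\<lparr>carrier := Z\<rparr> \<cong> integer_mod_group (if even f then 4 else 8)
    \<and> (clifford_weil f b)\<lparr>carrier := M\<rparr> Mod Z
        \<cong> (additive_group :: 'a monoid) \<times>\<times> (additive_group :: 'a monoid)
    \<and> clifford_weil f b Mod M \<cong> (SL2 :: ('a ^ 2 ^ 2) monoid)"
proof -
  interpret clifford_weil_setting f b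
    using assms by unfold_locales
  show ?thesis
    using Z_normal M_normal Z_subset_M Z_iso M_Mod_Z CW_Mod_M
    unfolding zord_def by blast
qed

end
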